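(* Let $Z$ be a lattice $3$-zonotope of lattice-width at least three and volume at least $196$. Then $\mu(Z)<\frac35$, except possibly if $Z$ is a parallelepiped projecting onto the parallelogram $P_{2,5}=[\mathbf 0,(1,0)]+[\mathbf 0,(2,5)]$.
   Context: A lattice $3$-zonotope is a three-dimensional zonotope in $\mathbb{R}^3$ that is a lattice translate of $\sum_i[\mathbf 0,\mathbf u_i]$ with finitely many generators $\mathbf u_i\in\mathbb{Z}^3$. The covering radius of a convex body $C\subseteq\mathbb{R}^d$ is $\mu(C)=\min\{\rho>0:\rho C+\mathbb{Z}^d=\mathbb{R}^d\}$. The lattice-width of $C$ is the minimum, over $\mathbf z\in\mathbb{Z}^d\setminus\{\mathbf 0\}$, of $\max_{\mathbf x\in C}\mathbf z^\intercal\mathbf x-\min_{\mathbf x\in C}\mathbf z^\intercal\mathbf x$. Two lattice polytopes $P,Q\subseteq\mathbb{R}^d$ are unimodularly equivalent if $P=UQ+\mathbf t$ for some $U\in\mathbb{Z}^{d\times d}$ with $|\det U|=1$ and $\mathbf t\in\mathbb{Z}^d$. "$Z$ projects onto $P_{2,5}$" means that there is a linear map $\pi:\mathbb{R}^3\to\mathbb{R}^2$ with $\pi(\mathbb{Z}^3)=\mathbb{Z}^2$ such that $\pi(Z)$ is unimodularly equivalent to $P_{2,5}$. *)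

theory Defs
  imports "HOL-Analysis.Analysis" "HOL-Library.Set_Algebras"
begin

text \<open>Throughout, \<open>+\<close> and \<open>\<Sum>\<close> on sets are Minkowski sums (\<^theory>\<open>HOL-Library.Set_Algebras\<close>);
  the empty sum is \<open>{0}\<close>.\<close>

definition int_lattice :: "(real ^ 'n) set" where
  "int_lattice = {x. \<forall>i. x $ i \<in> \<int>}"

definition zonotope :: "nat \<Rightarrow> (nat \<Rightarrow> real ^ 'n) \<Rightarrow> (real ^ 'n) set" where
  "zonotope n u = (\<Sum>i<n. closed_segment 0 (u i))"

text \<open>Generators may repeat, be parallel or be zero; only the zonotope itself has to be
  three-dimensional.\<close>

definition lattice_3_zonotope :: "(real ^ 3) set \<Rightarrow> bool" where
  "lattice_3_zonotope Z \<longleftrightarrow>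
     aff_dim Z = 3 \<and>
     (\<exists>n u. \<exists>t\<in>int_lattice. (\<forall>i<n. u i \<in> int_lattice) \<and> Z = (+) t ` zonotope n u)"

text \<open>For a convex body (compact, convex, with nonempty interior) the infimum is attained, so it is
  the minimum.\<close>

definition covering_radius :: "(real ^ 'n) set \<Rightarrow> real" where
  "covering_radius C = Inf {\<rho>. \<rho> > 0 \<and> (\<lambda>x. \<rho> *\<^sub>R x) ` C + int_lattice = UNIV}"

definition width_along :: "real ^ 'n \<Rightarrow> (real ^ 'n) set \<Rightarrow> real" where
  "width_along z C = (SUP x\<in>C. z \<bullet> x) - (INF x\<in>C. z \<bullet> x)"

text \<open>The suprema and infima are attained for compact nonempty \<open>C\<close>, and the outer infimum is a
  minimum for convex bodies.\<close>

definition lattice_width :: "(real ^ 'n) set \<Rightarrow> real" where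
  "lattice_width C = (INF z\<in>int_lattice - {0}. width_along z C)"

definition unimodularly_equivalent :: "(real ^ 'n) set \<Rightarrow> (real ^ 'n) set \<Rightarrow> bool" where
  "unimodularly_equivalent P Q \<longleftrightarrow>
     (\<exists>(U :: real ^ 'n ^ 'n). \<exists>t\<in>int_lattice.
        (\<forall>i j. U $ i $ j \<in> \<int>) \<and> \<bar>det U\<bar> = 1 \<and> P = (\<lambda>x. U *v x + t) ` Q)"

definition projects_onto :: "(real ^ 3) set \<Rightarrow> (real ^ 2) set \<Rightarrow> bool" where
  "projects_onto Z P \<longleftrightarrow>
     (\<exists>\<pi> :: real ^ 3 \<Rightarrow> real ^ 2.
        linear \<pi> \<and> \<pi> ` int_lattice = int_lattice \<and> unimodularly_equivalent (\<pi> ` Z) P)"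

text \<open>The edge vectors are arbitrary linearly independent real vectors: being a parallelepiped is a
  property of the set, independent of the generators used to present it as a zonotope.\<close>

definition parallelepiped :: "(real ^ 'n) set \<Rightarrow> bool" where
  "parallelepiped P \<longleftrightarrow>
     (\<exists>t (u :: 'n \<Rightarrow> real ^ 'n).
        inj u \<and> independent (range u) \<and> P = (+) t ` (\<Sum>i\<in>UNIV. closed_segment 0 (u i)))"

definition P_2_5 :: "(real ^ 2) set" where
  "P_2_5 = closed_segment 0 (vector [1, 0]) + closed_segment 0 (vector [2, 5])"

end

theory Submission
  imports Defs
begin

text \<open>
  If \<open>Z\<close> contains a chord of length \<open>s\<close> (in units of a primitive lattice vector \<open>z\<close>) and \<open>\<pi>\<close> is the lattice
  projection along \<open>z\<close>, then \<open>\<mu>(Z) \<le> \<mu>(\<pi>(Z)) + 1/s\<close>. Minkowski's theorem provides \<open>z\<close> with \<open>s = 29/5\<close>,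
  because \<open>(29/5)\<^sup>3 < 196\<close>, and Fubini's theorem improves this to \<open>s \<approx> 196/A\<close>, where \<open>A\<close> is the area of \<open>\<pi>(Z)\<close>.
  The projection is a planar lattice zonotope of width at least three. If \<open>A \<ge> 19\<close>, projecting once more,
  to the line, bounds its covering radius well enough. If \<open>A < 19\<close>, it suffices that the covering radius of
  \<open>\<pi>(Z)\<close> is at most \<open>1/2\<close>, and a study of the generators shows that this fails only for \<open>P_2_5\<close>; then all
  but two generators of \<open>Z\<close> are parallel to \<open>z\<close>, so \<open>Z\<close> is a parallelepiped.
\<close>

subsection \<open>Zonotopes, covering and lattice width\<close>

text \<open>The target 3/5 is spent as 1/2 + 1/10: for \<open>A < 19\<close> Fubini yields a chord
  longer than 10, which leaves 1/2 for the projection. For larger \<open>A\<close> the length 196/A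
  decays, so Minkowski's fixed 29/5 eventually replaces it. In the plane, width \<open>l\<close>
  across a Minkowski direction and a chord of length \<open>c\<close> along it give the bound 1/l +
  1/c, where \<open>c\<close> is almost A/3 if \<open>l = 3\<close> and almost sqrt A otherwise. The
  total is worst near A = 34, where 196/A meets 29/5; it is then about 0.595, both for
  \<open>l = 3\<close> and for \<open>l = 4\<close>. Two projections in a row are too wasteful for
  small \<open>A\<close>: already 1/3 + 3/A exceeds 1/2 when A < 18. There the generators themselves
  must be examined. Every argument but one looks for a parallelogram inside the zonotope that covers
  by itself; each generator either lengthens its chord or raises its height.\<close>

definition zon :: "'i set \<Rightarrow> ('i \<Rightarrow> 'a::real_vector) \<Rightarrow> 'a set" where
  "zon I u = {\<Sum>i\<in>I. s i *\<^sub>R u i | s. \<forall>i\<in>I. 0 \<le> s i \<and> s i \<le> 1}"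

text \<open>Coefficient vectors replace Minkowski sums: linear maps then act on the generators
  alone, and generators can be split off or regrouped.\<close>

lemma zonotope_eq_zon: "zonotope n u = zon {..<n} u"
proof -
  have "zonotope n u = {sum s {..<n} | s. \<forall>i\<in>{..<n}. s i \<in> closed_segment 0 (u i)}"
    unfolding zonotope_def by (simp add: set_sum_alt)
  also have "\<dots> = zon {..<n} u"
  proof (intro set_eqI iffI)
    fix x assume "x \<in> {sum s {..<n} | s. \<forall>i\<in>{..<n}. s i \<in> closed_segment 0 (u i)}"
    then obtain s where x: "x = sum s {..<n}" and s: "\<forall>i\<in>{..<n}. s i \<in> closed_segment 0 (u i)" by auto
    from s have "\<forall>i\<in>{..<n}. \<exists>a. 0 \<le> a \<and> a \<le> 1 \<and> s i = a *\<^sub>R u i" by (auto simp: in_segment)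
    then obtain a where "\<forall>i\<in>{..<n}. 0 \<le> a i \<and> a i \<le> 1 \<and> s i = a i *\<^sub>R u i" by metis
    then show "x \<in> zon {..<n} u" unfolding zon_def x by (auto intro!: exI[of _ a] sum.cong)
  next
    fix x assume "x \<in> zon {..<n} u"
    then obtain a where "x = (\<Sum>i<n. a i *\<^sub>R u i)" "\<forall>i<n. 0 \<le> a i \<and> a i \<le> 1" by (auto simp: zon_def)
    then show "x \<in> {sum s {..<n} | s. \<forall>i\<in>{..<n}. s i \<in> closed_segment 0 (u i)}"
      by (auto simp: in_segment intro!: exI[of _ "\<lambda>i. a i *\<^sub>R u i"])
  qed
  finally show ?thesis .
qed

lemma convex_zon: "convex (zon I u)"
proof (rule convexI)
  fix x y a b assume "x \<in> zon I u" "y \<in> zon I u" and ab: "0 \<le> a" "0 \<le> b" "a + b = (1::real)"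
  then obtain s t where s: "x = (\<Sum>i\<in>I. s i *\<^sub>R u i)" "\<forall>i\<in>I. 0 \<le> s i \<and> s i \<le> 1"
    and t: "y = (\<Sum>i\<in>I. t i *\<^sub>R u i)" "\<forall>i\<in>I. 0 \<le> t i \<and> t i \<le> 1" by (auto simp: zon_def)
  have "a *\<^sub>R x + b *\<^sub>R y = (\<Sum>i\<in>I. (a * s i + b * t i) *\<^sub>R u i)"
    by (simp add: s t scaleR_sum_right sum.distrib scaleR_left_distrib)
  moreover have "\<forall>i\<in>I. 0 \<le> a * s i + b * t i \<and> a * s i + b * t i \<le> 1"
    using s(2) t(2) ab by (auto intro!: convex_bound_le)
  ultimately show "a *\<^sub>R x + b *\<^sub>R y \<in> zon I u"
    unfolding zon_def by (intro CollectI exI[of _ "\<lambda>i. a * s i + b * t i"] conjI) auto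
qed

lemma linear_image_zon:
  assumes "linear f" shows "f ` zon I u = zon I (f \<circ> u)"
proof -
  have "f (\<Sum>i\<in>I. s i *\<^sub>R u i) = (\<Sum>i\<in>I. s i *\<^sub>R f (u i))" for s
    using assms by (simp add: linear_sum linear_scale)
  then show ?thesis unfolding zon_def by (auto simp: image_iff) metis
qed

lemma translate_linear_image:
  assumes "linear f" shows "f ` ((+) t ` S) = (+) (f t) ` (f ` S)"
  using assms by (auto simp: image_iff linear_add)

lemma compact_zon:
  fixes u :: "'i \<Rightarrow> 'a::real_normed_vector"
  assumes "finite I" shows "compact (zon I u)"
  using assms
proof (induction I rule: finite_induct)
  case empty then show ?case by (auto simp: zon_def)
next
  case (insert j I)
  have "zon (insert j I) u = {x + y | x y. x \<in> closed_segment 0 (u j) \<and> y \<in> zon I u}" (is "_ = ?R")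
  proof (intro set_eqI iffI)
    fix x assume "x \<in> zon (insert j I) u"
    then show "x \<in> ?R" using insert(1,2) by (fastforce simp: zon_def in_segment)
  next
    fix x assume "x \<in> ?R"
    then obtain a s where a: "0 \<le> a" "a \<le> 1" and s: "\<forall>i\<in>I. 0 \<le> s i \<and> s i \<le> 1"
      and x: "x = a *\<^sub>R u j + (\<Sum>i\<in>I. s i *\<^sub>R u i)" by (auto simp: zon_def in_segment)
    have "(\<Sum>i\<in>I. s i *\<^sub>R u i) = (\<Sum>i\<in>I. (s(j := a)) i *\<^sub>R u i)"
      using insert(2) by (intro sum.cong) auto
    then have "x = (\<Sum>i\<in>insert j I. (s(j := a)) i *\<^sub>R u i)"
      using insert(1,2) by (simp add: x)
    moreover have "\<forall>i\<in>insert j I. 0 \<le> (s(j := a)) i \<and> (s(j := a)) i \<le> 1" using a s by auto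
    ultimately show "x \<in> zon (insert j I) u" unfolding zon_def by blast
  qed
  then show ?case using insert.IH by (simp add: compact_sums)
qed

section \<open>Covering modulo the lattice and the fibre bound\<close>

lemma int_lattice_add: "x \<in> int_lattice \<Longrightarrow> y \<in> int_lattice \<Longrightarrow> x + y \<in> int_lattice"
  and int_lattice_diff: "x \<in> int_lattice \<Longrightarrow> y \<in> int_lattice \<Longrightarrow> x - y \<in> int_lattice"
  and int_lattice_minus: "x \<in> int_lattice \<Longrightarrow> - x \<in> int_lattice"
  and int_lattice_zero: "0 \<in> int_lattice"
  and int_lattice_scale: "c \<in> \<int> \<Longrightarrow> x \<in> int_lattice \<Longrightarrow> c *\<^sub>R x \<in> int_lattice"
  by (auto simp: int_lattice_def)

text \<open>Fixing the scale avoids the infimum: one covering scale below \<open>r\<close> already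
  bounds the covering radius strictly by \<open>r\<close>.\<close>

definition covers :: "real \<Rightarrow> (real ^ 'n) set \<Rightarrow> bool" where
  "covers \<rho> C \<longleftrightarrow> (\<forall>x. \<exists>c\<in>C. x - \<rho> *\<^sub>R c \<in> int_lattice)"

lemma covering_radius_less:
  fixes C :: "(real ^ 'a) set"
  assumes "covers \<rho> C" "0 < \<rho>" "\<rho> < r" shows "covering_radius C < r"
proof -
  have "(\<lambda>x. \<rho> *\<^sub>R x) ` C + int_lattice = UNIV"
  proof (intro equalityI subsetI UNIV_I)
    fix x :: "real^'a"
    obtain c where c: "c \<in> C" "x - \<rho> *\<^sub>R c \<in> int_lattice" using assms(1) by (auto simp: covers_def)
    then have "\<rho> *\<^sub>R c + (x - \<rho> *\<^sub>R c) \<in> (\<lambda>x. \<rho> *\<^sub>R x) ` C + int_lattice" by (intro set_plus_intro) auto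
    then show "x \<in> (\<lambda>x. \<rho> *\<^sub>R x) ` C + int_lattice" by simp
  qed
  then have "\<rho> \<in> {\<rho>. \<rho> > 0 \<and> (\<lambda>x. \<rho> *\<^sub>R x) ` C + int_lattice = UNIV}" using assms by simp
  then have "covering_radius C \<le> \<rho>" unfolding covering_radius_def
    by (rule cInf_lower) (auto intro!: bdd_belowI[of _ 0])
  then show ?thesis using assms by simp
qed

text \<open>After a lattice shift, the copy of \<open>C\<close> at scale \<open>\<rho>\<close>
  reaches the right fibre, leaving an error along \<open>z\<close>. Only its fractional part matters
  modulo the lattice, and the chord at scale 1/s is a full segment of length one along
  \<open>z\<close>, so it absorbs that part. By convexity the two copies add up to one at scale
  \<open>\<rho> + 1/s\<close>.\<close>

lemma covers_fibre:
  fixes \<pi> :: "real^'n \<Rightarrow> real^'m"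
  assumes "linear \<pi>" "convex C" "z \<in> int_lattice"
    and ker: "\<And>x. \<pi> x = 0 \<Longrightarrow> \<exists>s. x = s *\<^sub>R z"
    and surj: "\<And>l. l \<in> int_lattice \<Longrightarrow> \<exists>k\<in>int_lattice. \<pi> k = l"
    and cov: "covers \<rho> (\<pi> ` C)" and "\<rho> > 0"
    and chord: "x \<in> C" "x + s *\<^sub>R z \<in> C" "s > 0"
  shows "covers (\<rho> + 1 / s) C"
  unfolding covers_def
proof
  fix y
  define y' where "y' = y - (1/s) *\<^sub>R x"
  from cov obtain c where c: "c \<in> C" "\<pi> y' - \<rho> *\<^sub>R \<pi> c \<in> int_lattice" unfolding covers_def by blast
  then obtain k where k: "k \<in> int_lattice" "\<pi> k = \<pi> y' - \<rho> *\<^sub>R \<pi> c" using surj by blast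
  have "\<pi> (y' - \<rho> *\<^sub>R c - k) = 0" using k(2) assms(1) by (simp add: linear_diff linear_scale)
  then obtain a where a: "y' - \<rho> *\<^sub>R c - k = a *\<^sub>R z" using ker by blast
  \<comment> \<open>The point of the chord which at scale 1/s contributes \<open>frac a\<close>
    times \<open>z\<close>; the integer part of \<open>a\<close> goes to the lattice.\<close>
  define d where "d = x + (frac a * s) *\<^sub>R z"
  have "d = (1 - frac a) *\<^sub>R x + frac a *\<^sub>R (x + s *\<^sub>R z)" by (simp add: d_def algebra_simps)
  then have d: "d \<in> C" using chord(1,2) convexD[OF assms(2), of x "x + s *\<^sub>R z" "1 - frac a" "frac a"]
    frac_lt_1[of a] by (simp add: less_imp_le)
  \<comment> \<open>The weights are chosen so that \<open>\<rho> + 1/s\<close> times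
    \<open>e\<close> is \<open>\<rho>\<close> times \<open>c\<close> plus 1/s times
    \<open>d\<close>.\<close>
  define e where "e = (\<rho> / (\<rho> + 1/s)) *\<^sub>R c + ((1/s) / (\<rho> + 1/s)) *\<^sub>R d"
  have pos: "\<rho> + 1/s > 0" using assms chord by (simp add: add_pos_pos)
  have "\<rho> / (\<rho> + 1/s) + (1/s) / (\<rho> + 1/s) = (\<rho> + 1/s) / (\<rho> + 1/s)" by (rule add_divide_distrib[symmetric])
  also have "\<dots> = 1" using pos by simp
  finally have "\<rho> / (\<rho> + 1/s) + (1/s) / (\<rho> + 1/s) = 1" .
  then have "e \<in> C" unfolding e_def using pos \<open>\<rho> > 0\<close> \<open>s > 0\<close>
    by (intro convexD[OF assms(2)] c d) auto
  moreover have "y - (\<rho> + 1/s) *\<^sub>R e \<in> int_lattice"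
  proof -
    have "(\<rho> + 1/s) *\<^sub>R e = \<rho> *\<^sub>R c + (1/s) *\<^sub>R d"
      using pos by (simp add: e_def scaleR_add_right)
    also have "(1/s) *\<^sub>R d = (1/s) *\<^sub>R x + frac a *\<^sub>R z" using chord(3) by (simp add: d_def algebra_simps)
    finally have "y - (\<rho> + 1/s) *\<^sub>R e = y' - \<rho> *\<^sub>R c - frac a *\<^sub>R z" by (simp add: y'_def)
    also have "\<dots> = k + of_int \<lfloor>a\<rfloor> *\<^sub>R z" using a by (simp add: frac_def algebra_simps)
    finally show ?thesis using k(1) assms(3) by (simp add: int_lattice_add int_lattice_scale)
  qed
  ultimately show "\<exists>c\<in>C. y - (\<rho> + 1 / s) *\<^sub>R c \<in> int_lattice" by blast
qed

lemma chord_shorten: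
  assumes "convex C" "x \<in> C" "x + s *\<^sub>R z \<in> C" "0 \<le> t" "t \<le> s"
  shows "x + t *\<^sub>R z \<in> C"
proof (cases "s = 0")
  case False
  then have "x + t *\<^sub>R z = (1 - t/s) *\<^sub>R x + (t/s) *\<^sub>R (x + s *\<^sub>R z)" by (simp add: algebra_simps)
  then show ?thesis using assms False convexD[OF assms(1-3), of "1 - t/s" "t/s"] by simp
qed (use assms in auto)

section \<open>The width of a zonotope in terms of its generators\<close>

lemma width_along_zon_le:
  assumes "finite I"
  shows "width_along z ((+) t ` zon I u) \<le> (\<Sum>i\<in>I. \<bar>z \<bullet> u i\<bar>)"
proof -
  let ?Z = "(+) t ` zon I u"
  have ne: "?Z \<noteq> {}" by (auto simp: zon_def intro!: exI[of _ "\<lambda>_. 0"])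
  have *: "\<exists>s. x = z \<bullet> t + (\<Sum>i\<in>I. s i * (z \<bullet> u i)) \<and> (\<forall>i\<in>I. 0 \<le> s i \<and> s i \<le> 1)" if "x \<in> (\<lambda>x. z \<bullet> x) ` ?Z" for x
    using that by (auto simp: zon_def inner_add_right inner_sum_right)
  have "(SUP x\<in>?Z. z \<bullet> x) \<le> z \<bullet> t + (\<Sum>i\<in>I. max 0 (z \<bullet> u i))"
  proof (rule cSup_least)
    fix x assume "x \<in> (\<lambda>x. z \<bullet> x) ` ?Z"
    from *[OF this] obtain s where s: "x = z \<bullet> t + (\<Sum>i\<in>I. s i * (z \<bullet> u i))" "\<forall>i\<in>I. 0 \<le> s i \<and> s i \<le> 1" by auto
    have "s i * (z \<bullet> u i) \<le> max 0 (z \<bullet> u i)" if "i \<in> I" for i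
      using s(2) that by (cases "z \<bullet> u i \<ge> 0") (auto simp: mult_left_le_one_le mult_nonneg_nonpos)
    then show "x \<le> z \<bullet> t + (\<Sum>i\<in>I. max 0 (z \<bullet> u i))" by (auto simp: s intro!: sum_mono)
  qed (use ne in simp)
  moreover have "(INF x\<in>?Z. z \<bullet> x) \<ge> z \<bullet> t - (\<Sum>i\<in>I. max 0 (- (z \<bullet> u i)))"
  proof (rule cInf_greatest)
    fix x assume "x \<in> (\<lambda>x. z \<bullet> x) ` ?Z"
    from *[OF this] obtain s where s: "x = z \<bullet> t + (\<Sum>i\<in>I. s i * (z \<bullet> u i))" "\<forall>i\<in>I. 0 \<le> s i \<and> s i \<le> 1" by auto
    have "- (s i * (z \<bullet> u i)) \<le> max 0 (- (z \<bullet> u i))" if "i \<in> I" for i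
      using s(2) that mult_left_le_one_le[of "- (z \<bullet> u i)" "s i"]
      by (cases "z \<bullet> u i \<ge> 0") auto
    then have "(\<Sum>i\<in>I. - (s i * (z \<bullet> u i))) \<le> (\<Sum>i\<in>I. max 0 (- (z \<bullet> u i)))" by (intro sum_mono)
    then show "x \<ge> z \<bullet> t - (\<Sum>i\<in>I. max 0 (- (z \<bullet> u i)))" by (simp add: s sum_negf)
  qed (use ne in simp)
  moreover have "(\<Sum>i\<in>I. max 0 (z \<bullet> u i)) + (\<Sum>i\<in>I. max 0 (- (z \<bullet> u i))) = (\<Sum>i\<in>I. \<bar>z \<bullet> u i\<bar>)"
    by (auto simp: sum.distrib[symmetric] intro!: sum.cong)
  ultimately show ?thesis by (simp add: width_along_def)
qed

text \<open>Converts the width hypothesis into a lower bound for sums over generators, the form in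
  which all later arguments use it.\<close>

lemma lattice_width_zon_le:
  assumes "finite I" "z \<in> int_lattice" "z \<noteq> 0"
  shows "lattice_width ((+) t ` zon I u) \<le> (\<Sum>i\<in>I. \<bar>z \<bullet> u i\<bar>)"
proof -
  let ?Z = "(+) t ` zon I u"
  have c: "compact ?Z" using compact_translation[OF compact_zon[OF assms(1)]] by (simp add: image_def)
  have ne: "?Z \<noteq> {}" by (auto simp: zon_def intro!: exI[of _ "\<lambda>_. 0"])
  \<comment> \<open>Nonnegativity in every direction makes the set of widths bounded below, so that
    the infimum really is a lower bound.\<close>
  have "0 \<le> width_along y ?Z" for y
  proof -
    obtain x where x: "x \<in> ?Z" using ne by blast
    have "compact ((\<lambda>x. y \<bullet> x) ` ?Z)" by (intro compact_continuous_image c continuous_intros)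
    then have b: "bounded ((\<lambda>x. y \<bullet> x) ` ?Z)" by (rule compact_imp_bounded)
    have "(INF x\<in>?Z. y \<bullet> x) \<le> y \<bullet> x" using x b by (intro cINF_lower bounded_imp_bdd_below)
    also have "\<dots> \<le> (SUP x\<in>?Z. y \<bullet> x)" using x b by (intro cSUP_upper bounded_imp_bdd_above)
    finally show ?thesis by (simp add: width_along_def)
  qed
  then have "lattice_width ?Z \<le> width_along z ?Z" unfolding lattice_width_def
    using assms(2,3) by (intro cINF_lower) (auto intro!: bdd_belowI[of _ 0])
  then show ?thesis using width_along_zon_le[OF assms(1), of z t u] by linarith
qed

subsection \<open>Blichfeldt, Minkowski and Fubini\<close>

lemma finite_int_lattice_bounded: "finite {k \<in> int_lattice :: (real^'n) set. \<forall>i. \<bar>k $ i\<bar> \<le> B}"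
proof -
  have "{k \<in> int_lattice :: (real^'n) set. \<forall>i. \<bar>k $ i\<bar> \<le> B}
      \<subseteq> (\<lambda>f. \<chi> i. f i) ` (UNIV \<rightarrow>\<^sub>E of_int ` {\<lfloor>- B\<rfloor>..\<lceil>B\<rceil>})"
  proof
    fix k :: "real^'n" assume k: "k \<in> {k \<in> int_lattice. \<forall>i. \<bar>k $ i\<bar> \<le> B}"
    have "k $ i \<in> of_int ` {\<lfloor>- B\<rfloor>..\<lceil>B\<rceil>}" for i
    proof -
      have "k $ i \<in> \<int>" using k by (simp add: int_lattice_def)
      then obtain a where a: "k $ i = of_int a" by (rule Ints_cases)
      have "- B \<le> k $ i" "k $ i \<le> B" using k abs_le_D1[of "k $ i" B] abs_le_D2[of "k $ i" B] by (simp_all add: minus_le_iff)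
      then have "\<lfloor>- B\<rfloor> \<le> a" "a \<le> \<lceil>B\<rceil>" using a by linarith+
      then show ?thesis using a by auto
    qed
    then have "vec_nth k \<in> UNIV \<rightarrow>\<^sub>E of_int ` {\<lfloor>- B\<rfloor>..\<lceil>B\<rceil>}" by auto
    then show "k \<in> (\<lambda>f. \<chi> i. f i) ` (UNIV \<rightarrow>\<^sub>E of_int ` {\<lfloor>- B\<rfloor>..\<lceil>B\<rceil>})"
      by (intro image_eqI[of _ _ "vec_nth k"]) auto
  qed
  then show ?thesis by (rule finite_subset) (auto intro!: finite_imageI finite_PiE)
qed

text \<open>Cut \<open>S\<close> along the unit cells of the lattice and translate all pieces into
  the unit cube. If no two points of \<open>S\<close> were congruent, the translates would be
  disjoint and their total measure at most 1.\<close>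

lemma blichfeldt:
  fixes S :: "(real^'n) set"
  assumes "compact S" "measure lebesgue S > 1"
  shows "\<exists>x\<in>S. \<exists>y\<in>S. x \<noteq> y \<and> x - y \<in> int_lattice"
proof (rule ccontr)
  assume "\<not> ?thesis"
  then have neg: "\<And>x y. x \<in> S \<Longrightarrow> y \<in> S \<Longrightarrow> x \<noteq> y \<Longrightarrow> x - y \<notin> int_lattice" by blast
  define fl :: "real^'n \<Rightarrow> real^'n" where "fl x = (\<chi> i. of_int \<lfloor>x $ i\<rfloor>)" for x
  define Sk where "Sk k = {x \<in> S. fl x = k}" for k
  have flint: "fl x \<in> int_lattice" for x by (auto simp: fl_def int_lattice_def)
  obtain B where B: "\<And>x. x \<in> S \<Longrightarrow> norm x \<le> B"
    using compact_imp_bounded[OF assms(1)] by (auto simp: bounded_iff)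
  \<comment> \<open>Boundedness leaves finitely many cells, so finite additivity of the measure
    suffices.\<close>
  have fin: "finite (fl ` S)"
  proof (rule finite_subset[OF _ finite_int_lattice_bounded[of "B + 1"]], safe)
    fix x i assume "x \<in> S"
    then have "\<bar>x $ i\<bar> \<le> B" using B component_le_norm_cart[of x i] by force
    then show "\<bar>fl x $ i\<bar> \<le> B + 1" by (simp add: fl_def) linarith
  qed (rule flint)
  have meas: "Sk k \<in> lmeasurable" if "k \<in> fl ` S" for k
  proof -
    have [measurable]: "(\<lambda>x::real^'n. x $ i) \<in> borel_measurable borel" for i
      by (intro borel_measurable_continuous_onI continuous_intros)
    have "{x. fl x = k} = {x \<in> space borel. \<forall>i. real_of_int \<lfloor>x $ i\<rfloor> = k $ i}"
      by (simp add: fl_def vec_eq_iff)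
    also have "\<dots> \<in> sets borel" by measurable
    finally have "{x. fl x = k} \<in> sets borel" .
    then have "{x. fl x = k} \<in> sets lebesgue" by simp
    then have "S \<inter> {x. fl x = k} \<in> lmeasurable"
      using assms(1) by (meson fmeasurable_Int_fmeasurable lmeasurable_compact)
    then show ?thesis by (simp add: Sk_def Int_def)
  qed
  let ?T = "\<lambda>k. (+) (- k) ` Sk k"
  have measT: "?T k \<in> lmeasurable" if "k \<in> fl ` S" for k
    using meas[OF that] by (rule measurable_translation)
  have disjS: "pairwise (\<lambda>k l. negligible (Sk k \<inter> Sk l)) (fl ` S)"
  proof (rule pairwiseI)
    fix k l :: "real^'n" assume "k \<noteq> l"
    then have "Sk k \<inter> Sk l = {}" by (auto simp: Sk_def)
    then show "negligible (Sk k \<inter> Sk l)" by simp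
  qed
  have disjT: "pairwise (\<lambda>k l. negligible (?T k \<inter> ?T l)) (fl ` S)"
  proof (rule pairwiseI)
    fix k l assume kl: "k \<in> fl ` S" "l \<in> fl ` S" "k \<noteq> l"
    have "?T k \<inter> ?T l = {}"
    proof (rule equals0I)
      fix x assume "x \<in> ?T k \<inter> ?T l"
      then obtain a b where ab: "a \<in> Sk k" "b \<in> Sk l" "- k + a = - l + b" by auto
      then have "a - b = k - l" by (simp add: algebra_simps)
      moreover have "k - l \<in> int_lattice" using kl flint by (auto intro: int_lattice_diff)
      moreover have "a \<noteq> b" using kl(3) ab(1,2) by (auto simp: Sk_def)
      moreover have "a \<in> S" "b \<in> S" using ab(1,2) by (simp_all add: Sk_def)
      ultimately show False using neg[of a b] by simp
    qed
    then show "negligible (?T k \<inter> ?T l)" by simp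
  qed
  have "S = (\<Union>k\<in>fl ` S. Sk k)" by (auto simp: Sk_def)
  then have "measure lebesgue S = measure lebesgue (\<Union>k\<in>fl ` S. Sk k)" by simp
  also have "\<dots> = (\<Sum>k\<in>fl ` S. measure lebesgue (Sk k))"
    using measure_negligible_finite_Union_image[OF fin meas disjS] by simp
  also have "\<dots> = (\<Sum>k\<in>fl ` S. measure lebesgue (?T k))"
    by (simp only: measure_translation)
  also have "\<dots> = measure lebesgue (\<Union>k\<in>fl ` S. ?T k)"
    using measure_negligible_finite_Union_image[OF fin measT disjT] by simp
  also have "\<dots> \<le> measure lebesgue (cbox 0 (1::real^'n))"
  proof (rule measure_mono_fmeasurable)
    show "(\<Union>k\<in>fl ` S. ?T k) \<subseteq> cbox 0 1"
    proof
      fix y assume "y \<in> (\<Union>k\<in>fl ` S. ?T k)"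
      then obtain k x where "x \<in> Sk k" "y = - k + x" by blast
      then have y: "y = - fl x + x" by (simp add: Sk_def)
      have "0 \<le> y $ i \<and> y $ i \<le> 1" for i unfolding y fl_def by simp linarith
      then show "y \<in> cbox 0 1" by (simp add: mem_box_cart)
    qed
    show "(\<Union>k\<in>fl ` S. ?T k) \<in> sets lebesgue" 
      using measT by (intro sets.finite_UN fin) (simp add: fmeasurableD)
  qed simp
  also have "\<dots> = 1"
  proof -
    have "0 \<in> cbox 0 (1::real^'n)" by (simp add: mem_box_cart)
    then have "measure lborel (cbox 0 (1::real^'n)) = 1" by (subst content_cbox_cart) auto
    then show ?thesis by simp
  qed
  finally show False using assms(2) by simp
qed

text \<open>Blichfeldt's theorem for \<open>C\<close> scaled by 1/s: the lattice difference of two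
  of its points is the direction \<open>z\<close>, possibly a multiple of a shorter lattice
  vector.\<close>

lemma minkowski_chord:
  fixes C :: "(real^'n::{finite,wellorder}) set"
  assumes "compact C" "s > 0" "measure lebesgue C > s ^ CARD('n)"
  shows "\<exists>z\<in>int_lattice - {0}. \<exists>x. x \<in> C \<and> x + s *\<^sub>R z \<in> C"
proof -
  let ?S = "(*\<^sub>R) (1/s) ` C"
  have "measure lebesgue ?S = (1/s) ^ CARD('n) * measure lebesgue C"
    using measure_linear_image[of "(*\<^sub>R) (1/s)" C] assms(1,2)
    by (simp add: lmeasurable_compact linear_scaleR power_one_over)
  also have "\<dots> > (1/s) ^ CARD('n) * s ^ CARD('n)"
    using assms(2,3) by (intro mult_strict_left_mono) auto
  finally have "measure lebesgue ?S > 1" using assms(2) by (simp add: power_mult_distrib[symmetric])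
  moreover have "compact ?S" using assms(1) by (rule compact_scaling)
  ultimately obtain p q where pq: "p \<in> ?S" "q \<in> ?S" "p \<noteq> q" "p - q \<in> int_lattice"
    using blichfeldt by blast
  then obtain x y where "x \<in> C" "y \<in> C" "p = (1/s) *\<^sub>R x" "q = (1/s) *\<^sub>R y" by blast
  moreover from this have "y + s *\<^sub>R (p - q) = x" using assms(2) by (simp add: scaleR_diff_right)
  ultimately have "y \<in> C \<and> y + s *\<^sub>R (p - q) \<in> C" by simp
  then show ?thesis using pq(3,4) by (intro bexI[of _ "p - q"] exI[of _ y]) auto
qed

text \<open>Were there no such chord, convexity would confine every fibre to an interval of length
  \<open>s\<close>, and integrating over the projection would bound the volume by \<open>s\<close>
  times its measure.\<close>

lemma fubini_chord:
  fixes S :: "('a::euclidean_space \<times> real) set"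
  assumes "compact S" "convex S" "s > 0"
    and big: "measure lebesgue S > s * measure lebesgue (fst ` S)"
  shows "\<exists>w t. (w, t) \<in> S \<and> (w, t + s) \<in> S"
proof (rule ccontr)
  assume neg: "\<not> ?thesis"
  have far: "t' \<le> t + s" if "(w, t) \<in> S" "(w, t') \<in> S" for w t t'
  proof (rule ccontr)
    assume "\<not> t' \<le> t + s"
    then have "(w, t) + s *\<^sub>R (0, 1) \<in> S" using that assms(3)
      by (rule_tac chord_shorten[OF assms(2), of _ "t' - t"]) auto
    then show False using neg that(1) by auto
  qed
  have slice: "emeasure lborel (Pair w -` S) \<le> ennreal s * indicator (fst ` S) w" for w
  proof (cases "Pair w -` S = {}")
    case False
    have cl: "closed (Pair w -` S)"
      using compact_imp_closed[OF assms(1)] by (intro continuous_closed_vimage) (auto intro!: continuous_intros)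
    obtain t where t: "(w, t) \<in> S" using False by auto
    have "bdd_below (Pair w -` S)" using far[OF _ t] by (intro bdd_belowI[of _ "t - s"]) (auto simp: algebra_simps)
    then have inf: "Inf (Pair w -` S) \<in> Pair w -` S" using cl False by (intro closed_contains_Inf)
    have "Pair w -` S \<subseteq> {Inf (Pair w -` S)..Inf (Pair w -` S) + s}"
      using far inf \<open>bdd_below _\<close> cInf_lower[of _ "Pair w -` S"] by auto
    then have "emeasure lborel (Pair w -` S) \<le> emeasure lborel {Inf (Pair w -` S)..Inf (Pair w -` S) + s}"
      by (intro emeasure_mono) auto
    also have "\<dots> = ennreal s" using assms(3) by simp
    finally show ?thesis using t by (simp add: indicator_def rev_image_eqI[of "(w, t)"])
  qed auto
  have Sb: "S \<in> sets borel" "fst ` S \<in> sets borel"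
    using assms(1) by (auto intro!: borel_compact compact_continuous_image continuous_intros)
  have cf: "compact (fst ` S)" using assms(1) by (auto intro!: compact_continuous_image continuous_intros)
  have "emeasure lborel S = (\<integral>\<^sup>+ w. emeasure lborel (Pair w -` S) \<partial>lborel)"
  proof -
    have "S \<in> sets (lborel \<Otimes>\<^sub>M lborel)" using Sb(1) unfolding lborel_prod by simp
    from lborel.emeasure_pair_measure_alt[OF this] show ?thesis by (simp add: lborel_prod)
  qed
  also have "\<dots> \<le> (\<integral>\<^sup>+ w. ennreal s * indicator (fst ` S) w \<partial>lborel)"
    using slice by (rule nn_integral_mono)
  also have "\<dots> = ennreal s * emeasure lborel (fst ` S)" using Sb(2) by (simp add: nn_integral_cmult_indicator)
  finally have le: "emeasure lborel S \<le> ennreal s * emeasure lborel (fst ` S)" .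
  have fin: "emeasure lborel T = ennreal (measure lebesgue T)" if "compact T" for T :: "'c::euclidean_space set"
  proof -
    have "emeasure lborel T \<noteq> top" using emeasure_compact_finite[OF that] by auto
    then show ?thesis using that by (simp add: emeasure_eq_ennreal_measure borel_compact)
  qed
  have "emeasure lborel S = ennreal (measure lebesgue S)"
    "emeasure lborel (fst ` S) = ennreal (measure lebesgue (fst ` S))"
    using fin[OF assms(1)] fin[OF cf] by auto
  then have "ennreal (measure lebesgue S) \<le> ennreal (s * measure lebesgue (fst ` S))"
    using le assms(3) by (simp add: ennreal_mult)
  then show False using big assms(3) by (simp add: ennreal_le_iff)
qed

text \<open>Identifies a product such as \<open>(real^2) \<times> real\<close>, where Fubini is
  applied, with \<open>real^3\<close>, where the determinant formula is applied. Matching the bases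
  makes boxes pull back to boxes, which pins down the image of Lebesgue measure.\<close>

lemma measure_linear_Basis_image:
  fixes f :: "'a::euclidean_space \<Rightarrow> 'b::euclidean_space"
  assumes "linear f" "bij_betw f Basis Basis" "compact S"
  shows "measure lebesgue (f ` S) = measure lebesgue S"
proof -
  have inner: "f x \<bullet> f b = x \<bullet> b" if "b \<in> Basis" for x b
  proof -
    have "f x = f (\<Sum>c\<in>Basis. (x \<bullet> c) *\<^sub>R c)" by (simp add: euclidean_representation)
    also have "\<dots> = (\<Sum>c\<in>Basis. (x \<bullet> c) *\<^sub>R f c)" using assms(1) by (simp add: linear_sum linear_scale)
    finally have "f x \<bullet> f b = (\<Sum>c\<in>Basis. (x \<bullet> c) * (f c \<bullet> f b))" by (simp add: inner_sum_left)
    also have "\<dots> = (\<Sum>c\<in>Basis. (x \<bullet> c) * (if c = b then 1 else 0))"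
    proof (intro sum.cong refl)
      fix c :: 'a assume c: "c \<in> Basis"
      then have "f c \<in> Basis" "f b \<in> Basis" "f c = f b \<longleftrightarrow> c = b" using assms(2) that
        by (auto simp: bij_betw_def inj_on_def)
      then show "(x \<bullet> c) * (f c \<bullet> f b) = (x \<bullet> c) * (if c = b then 1 else 0)" by (simp add: inner_Basis)
    qed
    also have "\<dots> = x \<bullet> b" using that by (simp add: if_distrib[of "\<lambda>t. _ * t"] sum.delta cong: if_cong)
    finally show ?thesis .
  qed
  have Bas: "Basis = f ` Basis" using assms(2) by (simp add: bij_betw_def)
  have injB: "inj_on f Basis" using assms(2) by (simp add: bij_betw_def)
  \<comment> \<open>The adjoint of \<open>f\<close>, which is its inverse; it supplies the corners
    of the pulled back boxes.\<close>
  define g :: "'b \<Rightarrow> 'a" where "g y = (\<Sum>c\<in>Basis. (y \<bullet> f c) *\<^sub>R c)" for y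
  have ginner: "g y \<bullet> b = y \<bullet> f b" if "b \<in> Basis" for y b
    using that by (simp add: g_def inner_sum_left inner_Basis if_distrib[of "\<lambda>t. _ * t"] sum.delta cong: if_cong)
  have gf: "g (f x) = x" for x
    by (rule euclidean_eqI) (simp add: ginner inner)
  have meas: "f \<in> borel_measurable borel"
    using assms(1) by (intro borel_measurable_continuous_onI linear_continuous_on) (simp add: linear_conv_bounded_linear)
  have "lborel = distr lborel borel f"
  proof (rule lborel_eqI)
    fix l u :: 'b assume lu: "\<And>b. b \<in> Basis \<Longrightarrow> l \<bullet> b \<le> u \<bullet> b"
    have "f -` box l u = box (g l) (g u)"
      unfolding box_def by (subst Bas) (auto simp: inner ginner)
    then have "emeasure (distr lborel borel f) (box l u) = emeasure lborel (box (g l) (g u))"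
      using meas by (simp add: emeasure_distr)
    also have "\<dots> = (\<Prod>b\<in>Basis. (g u - g l) \<bullet> b)"
      using lu by (subst emeasure_lborel_box) (auto simp: ginner bij_betw_apply[OF assms(2)])
    also have "(\<Prod>b\<in>Basis. (g u - g l) \<bullet> b) = (\<Prod>b\<in>Basis. (u - l) \<bullet> b)"
    proof -
      have "(\<Prod>b\<in>f ` Basis. (u - l) \<bullet> b) = (\<Prod>b\<in>Basis. (g u - g l) \<bullet> b)"
        by (subst prod.reindex[OF injB]) (auto simp: inner_diff_left ginner intro!: prod.cong)
      then show ?thesis using Bas by simp
    qed
    finally show "emeasure (distr lborel borel f) (box l u) = (\<Prod>b\<in>Basis. (u - l) \<bullet> b)" .
  qed simp
  then have "emeasure lborel (f ` S) = emeasure (distr lborel borel f) (f ` S)" by simp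
  also have fS: "compact (f ` S)"
    using assms(1,3) by (intro compact_continuous_image linear_continuous_on) (simp_all add: linear_conv_bounded_linear)
  then have "emeasure (distr lborel borel f) (f ` S) = emeasure lborel (f -` (f ` S))"
    using meas by (simp add: emeasure_distr borel_compact)
  also have "f -` (f ` S) = S" using gf by (auto simp: image_iff) (metis gf)
  finally show ?thesis using fS assms(3) by (simp add: measure_def borel_compact)
qed

subsection \<open>Lattice projections\<close>

text \<open>The pair of \<open>\<pi>\<close> and \<open>\<eta>\<close> is a volume preserving change
  of coordinates, with inverse \<open>\<Phi>\<close> after \<open>T\<close>, in which
  \<open>z\<close> is the last coordinate direction. Fubini's chord in that direction is carried
  back to \<open>C\<close>.\<close>

lemma chord_projection:
  fixes \<pi> :: "real^'n::{finite,wellorder} \<Rightarrow> real^'m" and \<Phi> :: "real^'n::{finite,wellorder} \<Rightarrow> real^'n::{finite,wellorder}"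
    and T :: "(real^'m) \<times> real \<Rightarrow> real^'n::{finite,wellorder}"
  assumes lin: "linear \<Phi>" "linear T" "linear \<pi>" "linear \<eta>"
    and det: "\<bar>det (matrix \<Phi>)\<bar> = 1" and T: "bij_betw T Basis Basis"
    and inv: "\<And>x. \<Phi> (T (\<pi> x, \<eta> x)) = x" "\<And>w t. \<pi> (\<Phi> (T (w, t))) = w" "\<And>w t. \<eta> (\<Phi> (T (w, t))) = t"
    and z: "\<Phi> (T (0, 1)) = z"
    and C: "compact C" "convex C" "s > 0" "s * measure lebesgue (\<pi> ` C) < measure lebesgue C"
  shows "\<exists>x. x \<in> C \<and> x + s *\<^sub>R z \<in> C"
proof -
  define S where "S = (\<lambda>x. (\<pi> x, \<eta> x)) ` C"
  have lin': "linear (\<lambda>x. (\<pi> x, \<eta> x))"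
    using lin by (intro linearI) (auto simp: linear_add linear_scale)
  have S: "compact S" "convex S"
    unfolding S_def using C lin' by (auto intro!: compact_continuous_image linear_continuous_on
        convex_linear_image simp: linear_conv_bounded_linear)
  have CT: "C = \<Phi> ` (T ` S)" by (auto simp: S_def inv image_image)
  have cT: "compact (T ` S)" using S lin by (auto intro!: compact_continuous_image linear_continuous_on
        simp: linear_conv_bounded_linear)
  have "measure lebesgue C = measure lebesgue (T ` S)"
    unfolding CT using measure_linear_image[OF lin(1) lmeasurable_compact[OF cT]] det by simp
  also have "\<dots> = measure lebesgue S" by (rule measure_linear_Basis_image[OF lin(2) T S(1)])
  finally have "measure lebesgue C = measure lebesgue S" .
  moreover have "fst ` S = \<pi> ` C" by (simp add: S_def image_image)
  ultimately obtain w t where wt: "(w, t) \<in> S" "(w, t + s) \<in> S"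
    using fubini_chord[OF S C(3)] C(4) by auto
  have in_C: "\<Phi> (T p) \<in> C" if "p \<in> S" for p using that CT by blast
  have "\<Phi> (T ((w, t) + s *\<^sub>R (0, 1))) = \<Phi> (T (w, t)) + s *\<^sub>R z"
    using lin by (simp only: linear_add linear_scale z)
  then show ?thesis using in_C[OF wt(1)] in_C[OF wt(2)] by auto
qed

text \<open>Divide \<open>z\<close> by its content and complete the result to a lattice basis;
  \<open>\<pi>\<close> forgets the last coordinate. The statement about \<open>y\<close> pulls
  integer functionals back along \<open>\<pi>\<close>, so the projection inherits the lower bound on
  the width.\<close>

lemma primitive_projection_3:
  fixes z :: "real^3"
  assumes "z \<in> int_lattice" "z \<noteq> 0"
  obtains g z0 and \<pi> :: "real^3 \<Rightarrow> real^2" where "g \<ge> 1" "z = g *\<^sub>R z0" "z0 \<in> int_lattice" "z0 \<noteq> 0" "linear \<pi>" "\<pi> z0 = 0"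
    "\<And>x. \<pi> x = 0 \<Longrightarrow> \<exists>s. x = s *\<^sub>R z0"
    "\<pi> ` int_lattice = int_lattice"
    "\<And>y. y \<in> int_lattice - {0} \<Longrightarrow> \<exists>y'\<in>int_lattice - {0}. \<forall>x. y \<bullet> \<pi> x = y' \<bullet> x"
    "\<And>C s. compact C \<Longrightarrow> convex C \<Longrightarrow> s > 0 \<Longrightarrow> s * measure lebesgue (\<pi> ` C) < measure lebesgue C
      \<Longrightarrow> \<exists>x. x \<in> C \<and> x + s *\<^sub>R z0 \<in> C"
proof -
  have "z $ 1 \<in> \<int>" "z $ 2 \<in> \<int>" "z $ 3 \<in> \<int>" using assms(1) by (auto simp: int_lattice_def)
  then obtain za zb zc where zz: "z $ 1 = of_int za" "z $ 2 = of_int zb" "z $ 3 = of_int zc"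
    by (auto elim!: Ints_cases)
  define g where "g = gcd (gcd za zb) zc"
  have nz: "za \<noteq> 0 \<or> zb \<noteq> 0 \<or> zc \<noteq> 0" using assms(2) zz by (auto simp: vec_eq_iff forall_3)
  then have g: "g \<ge> 1" using gcd_ge_0_int[of "gcd za zb" zc] gcd_eq_0_iff[of "gcd za zb" zc]
    unfolding g_def by (smt (verit) gcd_eq_0_iff)
  obtain d c where dc: "gcd za zb = g * d" "zc = g * c" "coprime d c"
    using g unfolding g_def by (metis gcd_coprime_exists gcd_eq_0_iff mult.commute not_one_le_zero)
  \<comment> \<open>If the first two coordinates vanish, \<open>d\<close> is 0 and (1, 0) serves as
    the primitive pair.\<close>
  obtain a' b' s t where ab: "za = g * (d * a')" "zb = g * (d * b')" "s * a' + t * b' = 1"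
  proof (cases "gcd za zb = 0")
    case True
    then have "za = 0" "zb = 0" "d = 0" using dc(1) g by auto
    then show ?thesis using that[of 1 0 1 0] by simp
  next
    case False
    then obtain a' b' where "za = a' * gcd za zb" "zb = b' * gcd za zb" "coprime a' b'"
      using gcd_coprime_exists by blast
    moreover then obtain s t where "s * a' + t * b' = 1" using bezout_int[of a' b'] by auto
    ultimately show ?thesis using that[of a' b' s t] dc(1) by (metis mult.assoc mult.commute)
  qed
  obtain l m where "l * c + m * d = gcd c d" using bezout_int by blast
  then have "l * c + m * d = 1" using dc(3) by (simp add: coprime_iff_gcd_eq_1 gcd.commute)
  then obtain la where lm: "m * d - la * c = 1" using that by (metis add.commute diff_minus_eq_add mult_minus_left)
  define A B S T L M D G where "A = real_of_int a'" and "B = real_of_int b'" and "S = real_of_int s"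
    and "T = real_of_int t" and "L = real_of_int la" and "M = real_of_int m"
    and "D = real_of_int d" and "G = real_of_int c"
  have e1: "S * A + T * B = 1" using ab(3) unfolding A_def B_def S_def T_def by (metis of_int_1 of_int_add of_int_mult)
  have e2: "M * D - L * G = 1" using lm unfolding M_def D_def L_def G_def by (metis of_int_1 of_int_diff of_int_mult)
  have I: "A \<in> \<int>" "B \<in> \<int>" "S \<in> \<int>" "T \<in> \<int>" "L \<in> \<int>" "M \<in> \<int>" "D \<in> \<int>" "G \<in> \<int>"
    by (simp_all add: A_def B_def S_def T_def L_def M_def D_def G_def)
  \<comment> \<open>In the first two coordinates (A, B) is completed by (-T, S). In the plane of (A,
    B, 0) and the third axis, \<open>z0\<close> has coordinates (D, G) and is completed by (L, M).
    Thus \<open>g1\<close>, \<open>g2\<close>, \<open>z0\<close> form a lattice basis;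
    \<open>\<pi>\<close> and \<open>\<eta>\<close> are the dual coordinates.\<close>
  define z0 :: "real^3" where "z0 = vector [D * A, D * B, G]"
  define g1 :: "real^3" where "g1 = vector [- T, S, 0]"
  define g2 :: "real^3" where "g2 = vector [L * A, L * B, M]"
  define \<pi> :: "real^3 \<Rightarrow> real^2" where "\<pi> x = vector [A * x$2 - B * x$1, D * x$3 - G * S * x$1 - G * T * x$2]" for x
  define \<eta> :: "real^3 \<Rightarrow> real" where "\<eta> x = S * M * x$1 + T * M * x$2 - L * x$3" for x
  define \<Phi> :: "real^3 \<Rightarrow> real^3" where "\<Phi> v = v$1 *\<^sub>R g1 + v$2 *\<^sub>R g2 + v$3 *\<^sub>R z0" for v
  define TT :: "(real^2) \<times> real \<Rightarrow> real^3" where "TT p = vector [fst p $ 1, fst p $ 2, snd p]" for p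
  note defs = z0_def g1_def g2_def \<pi>_def \<eta>_def \<Phi>_def TT_def
  have lin: "linear \<pi>" "linear \<eta>" "linear \<Phi>" "linear TT"
    by (intro linearI; simp add: defs vec_eq_iff forall_3 forall_2 algebra_simps)+
  have i1: "\<Phi> (TT (\<pi> x, \<eta> x)) = x" for x
  proof -
    have "(\<Phi> (TT (\<pi> x, \<eta> x))) $ 1 = x $ 1"
      unfolding defs using e1 e2 by (simp, algebra)
    moreover have "(\<Phi> (TT (\<pi> x, \<eta> x))) $ 2 = x $ 2"
      unfolding defs using e1 e2 by (simp, algebra)
    moreover have "(\<Phi> (TT (\<pi> x, \<eta> x))) $ 3 = x $ 3"
      unfolding defs using e1 e2 by (simp, algebra)
    ultimately show ?thesis by (simp add: vec_eq_iff forall_3)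
  qed
  have i2: "\<pi> (\<Phi> (TT (w, t))) = w" for w t
  proof -
    have "(\<pi> (\<Phi> (TT (w, t)))) $ 1 = w $ 1"
      unfolding defs using e1 e2 by (simp, algebra)
    moreover have "(\<pi> (\<Phi> (TT (w, t)))) $ 2 = w $ 2"
      unfolding defs using e1 e2 by (simp, algebra)
    ultimately show ?thesis by (simp add: vec_eq_iff forall_2)
  qed
  have i3: "\<eta> (\<Phi> (TT (w, t))) = t" for w t
    unfolding defs using e1 e2 by (simp, algebra)
  have z1: "\<Phi> (TT (0, 1)) = z0" by (simp add: \<Phi>_def TT_def)
  have int: "g1 \<in> int_lattice" "g2 \<in> int_lattice" "z0 \<in> int_lattice"
    using I by (auto simp: defs int_lattice_def forall_3)
  show ?thesis
  proof (rule that[of "of_int g" z0 \<pi>])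
    show "real_of_int g \<ge> 1" using g by simp
    show "z = real_of_int g *\<^sub>R z0"
      using zz ab dc(2) by (simp add: vec_eq_iff forall_3 z0_def A_def B_def D_def G_def)
    then show "z0 \<noteq> 0" using assms(2) by auto
    show "\<pi> z0 = 0" using i2[of 0 1] z1 by simp
    show "\<exists>s. x = s *\<^sub>R z0" if "\<pi> x = 0" for x
    proof -
      have "x = \<Phi> (TT (0, \<eta> x))" using i1[of x] that by simp
      also have "\<dots> = \<eta> x *\<^sub>R z0" by (simp add: \<Phi>_def TT_def)
      finally show ?thesis by blast
    qed
    show "\<pi> ` int_lattice = int_lattice"
    proof (intro equalityI subsetI)
      fix y assume "y \<in> \<pi> ` int_lattice"
      then show "y \<in> int_lattice" using I by (auto simp: defs int_lattice_def forall_2)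
    next
      fix y :: "real^2" assume y: "y \<in> int_lattice"
      have "\<Phi> (TT (y, 0)) = y$1 *\<^sub>R g1 + y$2 *\<^sub>R g2" by (simp add: \<Phi>_def TT_def)
      also have "\<dots> \<in> int_lattice" using y int by (intro int_lattice_add int_lattice_scale) (auto simp: int_lattice_def)
      finally show "y \<in> \<pi> ` int_lattice" using i2[of y 0] by force
    qed
    show "\<exists>y'\<in>int_lattice - {0}. \<forall>x. y \<bullet> \<pi> x = y' \<bullet> x" if y: "y \<in> int_lattice - {0}" for y
    proof (intro bexI allI)
      let ?y = "vector [- B * y$1 - G * S * y$2, A * y$1 - G * T * y$2, D * y$2] :: real^3"
      show eq: "y \<bullet> \<pi> x = ?y \<bullet> x" for x
        by (simp add: inner_vec_def sum_2 sum_3 \<pi>_def algebra_simps)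
      \<comment> \<open>The functional takes the value \<open>y \<bullet> y\<close> at a preimage of
        \<open>y\<close>.\<close>
      have "?y \<noteq> 0"
      proof
        assume "?y = 0"
        then have "y \<bullet> \<pi> (\<Phi> (TT (y, 0))) = 0" using eq by simp
        then show False using y i2 by simp
      qed
      moreover have "y $ 1 \<in> \<int>" "y $ 2 \<in> \<int>" using y by (auto simp: int_lattice_def)
      ultimately show "?y \<in> int_lattice - {0}" using I by (auto simp: int_lattice_def forall_3)
    qed
    fix C :: "(real^3) set" and s :: real
    assume C: "compact C" "convex C" "s > 0" "s * measure lebesgue (\<pi> ` C) < measure lebesgue C"
    have "det (matrix \<Phi>) = 1"
      unfolding det_3 matrix_def defs using e1 e2 by (simp add: axis_def, algebra)
    moreover have "bij_betw TT Basis Basis"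
    proof -
      have B3: "(Basis :: (real^3) set) = {axis 1 1, axis 2 1, axis 3 1}"
        by (auto simp: Basis_vec_def UNIV_3)
      have B2: "Basis = {(axis 1 1, 0), (axis 2 1, 0), (0 :: real^2, 1::real)}"
        by (auto simp: Basis_prod_def Basis_vec_def UNIV_2)
      have TTB: "TT (axis 1 1, 0) = axis 1 1" "TT (axis 2 1, 0) = axis 2 1" "TT (0, 1) = axis 3 1"
        by (simp_all add: TT_def vec_eq_iff forall_3 axis_def)
      have "inj TT" by (rule inj_on_inverseI[of _ "\<lambda>x. (\<pi> (\<Phi> x), \<eta> (\<Phi> x))"]) (auto simp: i2 i3)
      moreover have "TT ` Basis = Basis" by (simp only: B2 B3 image_insert image_empty TTB)
      ultimately show ?thesis unfolding bij_betw_def using inj_on_subset by blast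
    qed
    ultimately show "\<exists>x. x \<in> C \<and> x + s *\<^sub>R z0 \<in> C"
      using lin i1 i2 i3 z1 C by (intro chord_projection[of \<Phi> TT \<pi> \<eta>]) auto
  qed (use lin int in auto)
qed

text \<open>The determinant. Up to a quarter turn, \<open>cr p\<close> is also the functional
  vanishing on the line of \<open>p\<close>, so one lattice vector names both a chord direction and
  the width across it.\<close>

definition cr :: "real^2 \<Rightarrow> real^2 \<Rightarrow> real" where
  "cr x y = x $ 1 * y $ 2 - x $ 2 * y $ 1"

lemma cr_linear [simp]:
  "cr x (y + z) = cr x y + cr x z" "cr (x + z) y = cr x y + cr z y"
  "cr x (y - z) = cr x y - cr x z" "cr (x - z) y = cr x y - cr z y"
  "cr x (a *\<^sub>R y) = a * cr x y" "cr (a *\<^sub>R x) y = a * cr x y"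
  "cr x (- y) = - cr x y" "cr (- x) y = - cr x y" "cr x x = 0" "cr x 0 = 0" "cr 0 x = 0"
  by (simp_all add: cr_def algebra_simps)

lemma cr_commute: "cr x y = - cr y x"
  by (simp add: cr_def)

lemma linear_cr: "linear (cr x)"
  by (intro linearI) auto

lemma cr_sum: "cr x (\<Sum>i\<in>I. f i) = (\<Sum>i\<in>I. cr x (f i))"
  by (rule linear_sum[OF linear_cr])

lemma cr_Ints: "x \<in> int_lattice \<Longrightarrow> y \<in> int_lattice \<Longrightarrow> cr x y \<in> \<int>"
  by (auto simp: cr_def int_lattice_def)

text \<open>Cramer's rule in the basis \<open>p\<close>, \<open>r\<close>.\<close>

lemma cr_expand: "cr p r = 1 \<Longrightarrow> x = cr x r *\<^sub>R p + cr p x *\<^sub>R r"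
proof -
  assume "cr p r = 1"
  then have "x $ 1 = cr x r * p $ 1 + cr p x * r $ 1" "x $ 2 = cr x r * p $ 2 + cr p x * r $ 2"
    unfolding cr_def by algebra+
  then show ?thesis by (simp add: vec_eq_iff forall_2)
qed

section \<open>Chords, widths and covering in the plane\<close>

lemma primitive_2:
  fixes z :: "real^2"
  assumes "z \<in> int_lattice" "z \<noteq> 0"
  obtains g p r where "g \<ge> 1" "g \<in> \<int>" "z = g *\<^sub>R p" "p \<in> int_lattice" "r \<in> int_lattice" "cr p r = 1"
proof -
  have "z $ 1 \<in> \<int>" "z $ 2 \<in> \<int>" using assms(1) by (auto simp: int_lattice_def)
  then obtain a b where zz: "z $ 1 = of_int a" "z $ 2 = of_int b" by (auto elim!: Ints_cases)
  have "a \<noteq> 0 \<or> b \<noteq> 0" using assms(2) zz by (auto simp: vec_eq_iff forall_2)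
  then have g: "gcd a b \<ge> 1" using gcd_ge_0_int[of a b] by (smt (verit) gcd_eq_0_iff)
  then obtain a' b' where ab: "a = a' * gcd a b" "b = b' * gcd a b" "coprime a' b'"
    using gcd_coprime_exists by (metis not_one_le_zero)
  obtain s t where st: "s * a' + t * b' = 1" using bezout_int[of a' b'] ab(3) by auto
  show ?thesis
  proof (rule that[of "of_int (gcd a b)" "vector [of_int a', of_int b']" "vector [of_int (- t), of_int s]"])
    show "z = real_of_int (gcd a b) *\<^sub>R vector [real_of_int a', real_of_int b']"
      using ab(1,2) by (simp add: vec_eq_iff forall_2 zz flip: of_int_mult) (metis mult.commute)
    have "real_of_int (s * a' + t * b') = 1" using st by simp
    then show "cr (vector [real_of_int a', real_of_int b']) (vector [of_int (- t), of_int s]) = 1"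
      by (simp add: cr_def algebra_simps)
  qed (use g in \<open>auto simp: int_lattice_def forall_2\<close>)
qed

text \<open>Valued in \<open>real^1\<close> rather than \<open>real\<close>, so that the results on
  projections between cartesian spaces apply to it.\<close>

definition proj1 :: "real^2 \<Rightarrow> real^2 \<Rightarrow> real^1" where
  "proj1 p x = (\<chi> i. cr p x)"

lemma linear_proj1: "linear (proj1 p)"
  by (intro linearI) (auto simp: proj1_def vec_eq_iff)

lemma chord_2:
  fixes C :: "(real^2) set"
  assumes "cr p r = 1" "compact C" "convex C" "s > 0" "s * measure lebesgue (proj1 p ` C) < measure lebesgue C"
  shows "\<exists>x. x \<in> C \<and> x + s *\<^sub>R p \<in> C"
proof (rule chord_projection[where \<Phi> = "\<lambda>v. v$1 *\<^sub>R r + v$2 *\<^sub>R p" and T = "\<lambda>q. vector [fst q $ 1, snd q]"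
      and \<eta> = "\<lambda>x. cr x r" and \<pi> = "proj1 p"])
  let ?T = "\<lambda>q::(real^1)\<times>real. vector [fst q $ 1, snd q] :: real^2"
  let ?\<Phi> = "\<lambda>v. v$1 *\<^sub>R r + v$2 *\<^sub>R p"
  show "linear ?\<Phi>" "linear (\<lambda>x. cr x r)" by (intro linearI; simp add: algebra_simps)+
  show "linear ?T" by (intro linearI; simp add: vec_eq_iff forall_2)
  show "linear (proj1 p)" by (rule linear_proj1)
  show "\<bar>det (matrix ?\<Phi>)\<bar> = 1"
    using assms(1) unfolding det_2 matrix_def cr_def by (simp add: axis_def algebra_simps)
  have B2: "(Basis :: (real^2) set) = {axis 1 1, axis 2 1}" by (auto simp: Basis_vec_def UNIV_2)
  have B1: "Basis = {(axis 1 1, 0), (0 :: real^1, 1::real)}"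
    by (auto simp: Basis_prod_def Basis_vec_def UNIV_1)
  have TB: "?T (axis 1 1, 0) = axis 1 1" "?T (0, 1) = axis 2 1"
    by (simp_all add: vec_eq_iff forall_2 axis_def)
  have "inj ?T" by (rule inj_on_inverseI[of _ "\<lambda>x. (\<chi> i. x $ 1, x $ 2)"]) (auto simp: vec_eq_iff forall_1)
  moreover have "?T ` Basis = Basis" by (simp only: B2 B1 image_insert image_empty TB)
  ultimately show "bij_betw ?T Basis Basis" unfolding bij_betw_def using inj_on_subset by blast
  show "?\<Phi> (?T (proj1 p x, cr x r)) = x" for x
    using cr_expand[OF assms(1), of x] by (simp add: proj1_def add.commute)
  show "proj1 p (?\<Phi> (?T (w, t))) = w" for w t using assms(1) by (simp add: proj1_def vec_eq_iff forall_1)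
  show "cr (?\<Phi> (?T (w, t))) r = t" for w t using assms(1) by simp
  show "?\<Phi> (?T (0, 1)) = p" by simp
qed (use assms in auto)

text \<open>Both endpoints are attained with coefficients 0 and 1 chosen by sign; convexity fills
  the interval between them.\<close>

lemma cr_zon:
  fixes u :: "'i \<Rightarrow> real^2"
  assumes "finite I" and l: "l = (\<Sum>i\<in>I. \<bar>cr p (u i)\<bar>)"
  obtains m where "cr p ` zon I u = {m..m + l}"
proof
  let ?m = "\<Sum>i\<in>I. min 0 (cr p (u i))"
  have ml: "?m + l = (\<Sum>i\<in>I. max 0 (cr p (u i)))"
    unfolding l sum.distrib[symmetric] by (intro sum.cong) auto
  show "cr p ` zon I u = {?m..?m + l}"
  proof (intro equalityI subsetI)
    fix y assume "y \<in> cr p ` zon I u"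
    then obtain s where s: "y = (\<Sum>i\<in>I. s i * cr p (u i))" "\<forall>i\<in>I. 0 \<le> s i \<and> s i \<le> 1"
      by (auto simp: zon_def cr_sum)
    have "min 0 (cr p (u i)) \<le> s i * cr p (u i)" "s i * cr p (u i) \<le> max 0 (cr p (u i))" if "i \<in> I" for i
      using s(2) that mult_left_le_one_le[of "cr p (u i)" "s i"] mult_left_le_one_le[of "- cr p (u i)" "s i"]
        mult_nonneg_nonpos[of "s i" "cr p (u i)"] mult_nonneg_nonneg[of "s i" "cr p (u i)"]
      by (cases "cr p (u i) \<ge> 0"; simp)+
    then show "y \<in> {?m..?m + l}" unfolding ml by (auto simp: s(1) intro!: sum_mono)
  next
    have cv: "convex (cr p ` zon I u)" by (intro convex_linear_image linear_cr convex_zon)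
    have "?m = cr p (\<Sum>i\<in>I. (if cr p (u i) < 0 then 1 else 0) *\<^sub>R u i)"
      by (auto simp: cr_sum intro!: sum.cong)
    moreover have "\<dots> \<in> cr p ` zon I u"
      unfolding zon_def by (intro imageI CollectI exI conjI) auto
    ultimately have 1: "?m \<in> cr p ` zon I u" by simp
    have "?m + l = cr p (\<Sum>i\<in>I. (if cr p (u i) > 0 then 1 else 0) *\<^sub>R u i)"
      unfolding ml by (auto simp: cr_sum intro!: sum.cong)
    moreover have "\<dots> \<in> cr p ` zon I u"
      unfolding zon_def by (intro imageI CollectI exI conjI) auto
    ultimately have 2: "?m + l \<in> cr p ` zon I u" by simp
    fix y assume "y \<in> {?m..?m + l}"
    then show "y \<in> cr p ` zon I u" using 1 2 cv
      by (meson atLeastAtMost_iff is_interval_convex_1 mem_is_interval_1_I)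
  qed
qed

text \<open>The fibre bound over the line, where an interval of length \<open>l\<close> covers at
  scale 1/l.\<close>

lemma covers_chord_2:
  fixes u :: "'i \<Rightarrow> real^2"
  assumes "finite I" and l: "l = (\<Sum>i\<in>I. \<bar>cr p (u i)\<bar>)" "l > 0"
    and p: "p \<in> int_lattice" "r \<in> int_lattice" "cr p r = 1"
    and chord: "x \<in> zon I u" "x + s *\<^sub>R p \<in> zon I u" "s > 0"
  shows "covers (1 / l + 1 / s) (zon I u)"
proof (rule covers_fibre[OF linear_proj1 convex_zon p(1) _ _ _ _ chord])
  show "\<exists>s. x = s *\<^sub>R p" if "proj1 p x = 0" for x
    using cr_expand[OF p(3), of x] that by (auto simp: proj1_def vec_eq_iff)
  show "\<exists>k\<in>int_lattice. proj1 p k = l" if "l \<in> int_lattice" for l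
    using that p by (intro bexI[of _ "l $ 1 *\<^sub>R r"])
      (auto simp: proj1_def vec_eq_iff forall_1 intro!: int_lattice_scale, auto simp: int_lattice_def)
  show "1 / l > 0" using l by simp
  obtain m where m: "cr p ` zon I u = {m..m + l}" using cr_zon[OF assms(1,2)] by blast
  show "covers (1 / l) (proj1 p ` zon I u)"
    unfolding covers_def
  proof
    fix x :: "real^1"
    \<comment> \<open>Divided by \<open>l\<close>, this point differs from \<open>x $ 1\<close> by
      an integer.\<close>
    have "m + frac (x $ 1 - m / l) * l \<in> cr p ` zon I u"
      unfolding m using l(2) frac_lt_1[of "x $ 1 - m / l"] by (simp add: mult_left_le_one_le less_imp_le)
    then obtain c where c: "c \<in> zon I u" "cr p c = m + frac (x $ 1 - m / l) * l" by auto
    have "x $ 1 - (1 / l) * cr p c = of_int \<lfloor>x $ 1 - m / l\<rfloor>"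
      unfolding c(2) using l(2) by (simp add: frac_def field_simps)
    then show "\<exists>c\<in>proj1 p ` zon I u. x - (1 / l) *\<^sub>R c \<in> int_lattice"
      using c(1) by (intro bexI[of _ "proj1 p c"]) (auto simp: proj1_def int_lattice_def forall_1)
  qed
qed

lemma measure_proj1_zon:
  fixes u :: "'i \<Rightarrow> real^2"
  assumes "finite I"
  shows "measure lebesgue (proj1 p ` zon I u) \<le> (\<Sum>i\<in>I. \<bar>cr p (u i)\<bar>)"
proof -
  define l where "l = (\<Sum>i\<in>I. \<bar>cr p (u i)\<bar>)"
  have l0: "l \<ge> 0" unfolding l_def by (simp add: sum_nonneg)
  obtain m where m: "cr p ` zon I u = {m..m + l}" using cr_zon[OF assms l_def] by blast
  let ?b = "cbox (vec m) (vec (m + l)) :: (real^1) set"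
  have "proj1 p ` zon I u \<subseteq> ?b"
    using m by (auto simp: proj1_def mem_box_cart)
  moreover have "compact (proj1 p ` zon I u)"
    by (intro compact_continuous_image linear_continuous_on compact_zon assms)
      (simp add: linear_proj1 flip: linear_conv_bounded_linear)
  ultimately have "measure lebesgue (proj1 p ` zon I u) \<le> measure lebesgue ?b"
    by (intro measure_mono_fmeasurable) (auto simp: fmeasurableD lmeasurable_compact)
  also have "\<dots> = measure lborel ?b" by simp
  also have "\<dots> = l" using l0 by (subst content_cbox_cart) (auto simp: interval_eq_empty_cart)
  finally show ?thesis unfolding l_def .
qed

subsection \<open>Planar zonotopes: parallelograms\<close>

text \<open>\<open>bzon I u\<close> is \<open>zon I u\<close> doubled and moved to the origin, so \<open>zon I u / 2\<close> covers modulo the lattice as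
  soon as \<open>bzon I u\<close> covers modulo four times the lattice. Unlike \<open>zon\<close>, it does not change when
  generators change sign.\<close>

definition bzon :: "'i set \<Rightarrow> ('i \<Rightarrow> 'a::real_vector) \<Rightarrow> 'a set" where
  "bzon I u = {\<Sum>i\<in>I. s i *\<^sub>R u i | s. \<forall>i\<in>I. \<bar>s i\<bar> \<le> 1}"

definition covers4 :: "(real ^ 'n) set \<Rightarrow> bool" where
  "covers4 D \<longleftrightarrow> (\<forall>x. \<exists>l\<in>int_lattice. x - 4 *\<^sub>R l \<in> D)"

lemma covers_half_zon:
  assumes "covers4 (bzon I u)" shows "covers (1/2) (zon I u)"
  unfolding covers_def
proof
  fix x
  obtain l where l: "l \<in> int_lattice" "4 *\<^sub>R x - (\<Sum>i\<in>I. u i) - 4 *\<^sub>R l \<in> bzon I u"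
    using assms unfolding covers4_def by blast
  then obtain s where s: "4 *\<^sub>R x - (\<Sum>i\<in>I. u i) - 4 *\<^sub>R l = (\<Sum>i\<in>I. s i *\<^sub>R u i)" "\<forall>i\<in>I. \<bar>s i\<bar> \<le> 1"
    unfolding bzon_def by blast
  let ?c = "\<Sum>i\<in>I. ((1 + s i) / 2) *\<^sub>R u i"
  have "?c = (1/2) *\<^sub>R ((\<Sum>i\<in>I. u i) + (\<Sum>i\<in>I. s i *\<^sub>R u i))"
    by (simp add: scaleR_sum_right sum.distrib[symmetric] scaleR_add_left add_divide_distrib scaleR_add_right)
  also have "\<dots> = 2 *\<^sub>R x - 2 *\<^sub>R l" unfolding s(1)[symmetric] by (simp add: scaleR_add_right scaleR_diff_right)
  finally have "x - (1/2) *\<^sub>R ?c = l" by (simp add: scaleR_diff_right)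
  moreover have "?c \<in> zon I u" unfolding zon_def using s(2) by (intro CollectI exI conjI) (auto simp: abs_le_iff)
  ultimately show "\<exists>c\<in>zon I u. x - (1/2) *\<^sub>R c \<in> int_lattice" using l(1) by (intro bexI[of _ ?c]) auto
qed

lemma convex_bzon: "convex (bzon I u)"
proof (rule convexI)
  fix x y a b assume "x \<in> bzon I u" "y \<in> bzon I u" and ab: "0 \<le> a" "0 \<le> b" "a + b = (1::real)"
  then obtain s t where s: "x = (\<Sum>i\<in>I. s i *\<^sub>R u i)" "\<forall>i\<in>I. \<bar>s i\<bar> \<le> 1"
    and t: "y = (\<Sum>i\<in>I. t i *\<^sub>R u i)" "\<forall>i\<in>I. \<bar>t i\<bar> \<le> 1" by (auto simp: bzon_def)
  have "a *\<^sub>R x + b *\<^sub>R y = (\<Sum>i\<in>I. (a * s i + b * t i) *\<^sub>R u i)"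
    by (simp add: s t scaleR_sum_right sum.distrib scaleR_left_distrib)
  moreover have "\<bar>a * s i + b * t i\<bar> \<le> 1" if "i \<in> I" for i
  proof -
    have "\<bar>a * s i + b * t i\<bar> \<le> a * \<bar>s i\<bar> + b * \<bar>t i\<bar>"
      using abs_triangle_ineq[of "a * s i" "b * t i"] ab by (simp add: abs_mult)
    also have "\<dots> \<le> 1" using s(2) t(2) that ab by (intro convex_bound_le) auto
    finally show ?thesis .
  qed
  ultimately show "a *\<^sub>R x + b *\<^sub>R y \<in> bzon I u"
    unfolding bzon_def by (intro CollectI exI[of _ "\<lambda>i. a * s i + b * t i"] conjI) auto
qed

lemma bzon_minus: "x \<in> bzon I u \<Longrightarrow> - x \<in> bzon I u"
proof -
  assume "x \<in> bzon I u"
  then obtain s where "x = (\<Sum>i\<in>I. s i *\<^sub>R u i)" "\<forall>i\<in>I. \<bar>s i\<bar> \<le> 1" by (auto simp: bzon_def)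
  then show ?thesis unfolding bzon_def
    by (intro CollectI exI[of _ "\<lambda>i. - s i"]) (auto simp: sum_negf)
qed

lemma bzon_zero: "0 \<in> bzon I u"
  unfolding bzon_def by (intro CollectI exI[of _ "\<lambda>_. 0"]) auto

lemma bzon_insert:
  assumes "finite I" "i \<in> I" "\<bar>a\<bar> \<le> 1" "x \<in> bzon (I - {i}) u"
  shows "a *\<^sub>R u i + x \<in> bzon I u"
proof -
  obtain s where s: "x = (\<Sum>i\<in>I - {i}. s i *\<^sub>R u i)" "\<forall>j\<in>I - {i}. \<bar>s j\<bar> \<le> 1"
    using assms(4) by (auto simp: bzon_def)
  have "(\<Sum>j\<in>I. (s(i := a)) j *\<^sub>R u j) = a *\<^sub>R u i + (\<Sum>j\<in>I - {i}. (s(i := a)) j *\<^sub>R u j)"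
    using assms(1,2) by (subst sum.remove[of _ i]) auto
  also have "(\<Sum>j\<in>I - {i}. (s(i := a)) j *\<^sub>R u j) = x" unfolding s(1) by (intro sum.cong) auto
  finally show ?thesis unfolding bzon_def using s(2) assms(3)
    by (intro CollectI exI[of _ "s(i := a)"]) auto
qed

text \<open>Coefficient zero on all other generators: a sum over a few of them is enough to exhibit
  a covering parallelogram.\<close>

lemma bzon_2:
  assumes "finite I" "i \<in> I" "j \<in> I" "i \<noteq> j" "\<bar>a\<bar> \<le> 1" "\<bar>b\<bar> \<le> 1"
  shows "a *\<^sub>R u i + b *\<^sub>R u j \<in> bzon I u"
  using assms bzon_insert[of I i a "b *\<^sub>R u j + 0" u] bzon_insert[of "I - {i}" j b 0 u]
    bzon_zero[of "I - {i} - {j}" u] by simp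

lemma bzon_3:
  assumes "finite I" "i \<in> I" "j \<in> I" "k \<in> I" "i \<noteq> j" "k \<noteq> i" "k \<noteq> j" "\<bar>a\<bar> \<le> 1" "\<bar>b\<bar> \<le> 1" "\<bar>c\<bar> \<le> 1"
  shows "a *\<^sub>R u i + b *\<^sub>R u j + c *\<^sub>R u k \<in> bzon I u"
  using assms bzon_insert[of I i a "b *\<^sub>R u j + c *\<^sub>R u k" u] bzon_2[of "I - {i}" j k b c u]
  by (simp add: add.assoc)

lemma bzon_4:
  assumes "finite I" "i \<in> I" "j \<in> I" "k \<in> I" "l \<in> I" "i \<noteq> j" "k \<noteq> i" "k \<noteq> j" "l \<noteq> i" "l \<noteq> j" "l \<noteq> k"
    "\<bar>a\<bar> \<le> 1" "\<bar>b\<bar> \<le> 1" "\<bar>c\<bar> \<le> 1" "\<bar>d\<bar> \<le> 1"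
  shows "a *\<^sub>R u i + b *\<^sub>R u j + c *\<^sub>R u k + d *\<^sub>R u l \<in> bzon I u"
  using assms bzon_insert[of I i a "b *\<^sub>R u j + c *\<^sub>R u k + d *\<^sub>R u l" u] bzon_3[of "I - {i}" j k l b c d u]
  by (simp add: add.assoc)

text \<open>By symmetry \<open>D\<close> contains the parallelogram with vertices \<open>\<plusminus>y \<plusminus> 2p\<close>. Every line parallel to \<open>p\<close>, shifted
  by a suitable multiple of \<open>4r\<close>, meets it in a chord of length four.\<close>

lemma covers4_parallelogram:
  assumes p: "p \<in> int_lattice" "r \<in> int_lattice" "\<bar>cr p r\<bar> = 1"
    and D: "convex D" "\<And>x. x \<in> D \<Longrightarrow> - x \<in> D"
    and y: "y + 2 *\<^sub>R p \<in> D" "y - 2 *\<^sub>R p \<in> D" "\<bar>cr p y\<bar> \<ge> 2"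
  shows "covers4 D"
  unfolding covers4_def
proof
  fix x
  define e where "e = cr p r"
  define r' where "r' = e *\<^sub>R r"
  have e: "e = 1 \<or> e = -1" using p(3) unfolding e_def by linarith
  have r': "r' \<in> int_lattice" "cr p r' = 1"
    using e p by (auto simp: r'_def e_def intro: int_lattice_minus)
  \<comment> \<open>Reduction modulo 4 to representatives between -2 and 2, used first for the
    height across \<open>p\<close> and then along \<open>p\<close>.\<close>
  have fl: "-2 \<le> X - 4 * of_int \<lfloor>(X + 2) / 4\<rfloor>" "X - 4 * of_int \<lfloor>(X + 2) / 4\<rfloor> \<le> 2" for X :: real
  proof -
    have "of_int \<lfloor>(X + 2) / 4\<rfloor> \<le> (X + 2) / 4" "(X + 2) / 4 < of_int \<lfloor>(X + 2) / 4\<rfloor> + 1" by linarith+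
    then show "-2 \<le> X - 4 * of_int \<lfloor>(X + 2) / 4\<rfloor>" "X - 4 * of_int \<lfloor>(X + 2) / 4\<rfloor> \<le> 2" by argo+
  qed
  define k where "k = (of_int \<lfloor>(cr p x + 2) / 4\<rfloor> :: real)"
  define h where "h = cr p x - 4 * k"
  have h: "-2 \<le> h" "h \<le> 2" unfolding h_def k_def by (rule fl)+
  \<comment> \<open>The height of \<open>y\<close> across \<open>p\<close> is at least 2 in absolute
    value, so the segment from \<open>- y\<close> to \<open>y\<close> meets the required height
    \<open>h\<close>.\<close>
  define t where "t = h / cr p y"
  have t: "\<bar>t\<bar> \<le> 1" "t * cr p y = h" using h y(3) by (auto simp: t_def abs_if divide_simps split: if_splits)
  define a where "a = cr (x - (4 * k) *\<^sub>R r' - t *\<^sub>R y) r'"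
  have xa: "x - (4 * k) *\<^sub>R r' - t *\<^sub>R y = a *\<^sub>R p"
    using cr_expand[OF r'(2), of "x - (4 * k) *\<^sub>R r' - t *\<^sub>R y"] t(2) r'(2) by (simp add: a_def h_def)
  define j where "j = (of_int \<lfloor>(a + 2) / 4\<rfloor> :: real)"
  define b where "b = a - 4 * j"
  have b: "-2 \<le> b" "b \<le> 2" unfolding b_def j_def by (rule fl)+
  have seg: "z + b *\<^sub>R p \<in> D" if "z + 2 *\<^sub>R p \<in> D" "z - 2 *\<^sub>R p \<in> D" for z
  proof -
    have "z + b *\<^sub>R p = ((2 + b) / 4) *\<^sub>R (z + 2 *\<^sub>R p) + ((2 - b) / 4) *\<^sub>R (z - 2 *\<^sub>R p)"
      by (simp add: vec_eq_iff field_simps)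
    also have "\<dots> \<in> D" using b by (intro convexD[OF D(1) that]) (auto simp: field_simps)
    finally show ?thesis .
  qed
  have 1: "y + b *\<^sub>R p \<in> D" using y by (intro seg)
  have 2: "- y + b *\<^sub>R p \<in> D" using D(2)[OF y(1)] D(2)[OF y(2)] by (intro seg) (simp_all add: add.commute)
  have "t *\<^sub>R y + b *\<^sub>R p = ((1 + t) / 2) *\<^sub>R (y + b *\<^sub>R p) + ((1 - t) / 2) *\<^sub>R (- y + b *\<^sub>R p)"
    by (simp add: vec_eq_iff field_simps)
  also have "\<dots> \<in> D" using t(1) by (intro convexD[OF D(1) 1 2]) (auto simp: field_simps abs_le_iff)
  finally have "t *\<^sub>R y + b *\<^sub>R p \<in> D" .
  moreover have "x - 4 *\<^sub>R (k *\<^sub>R r' + j *\<^sub>R p) = t *\<^sub>R y + b *\<^sub>R p"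
    using xa by (simp add: b_def algebra_simps)
  moreover have "k *\<^sub>R r' + j *\<^sub>R p \<in> int_lattice"
    using p(1) r'(1) unfolding k_def j_def by (intro int_lattice_add int_lattice_scale) auto
  ultimately show "\<exists>l\<in>int_lattice. x - 4 *\<^sub>R l \<in> D" by metis
qed

text \<open>Generators parallel to \<open>p\<close> of total length at least 2 provide the shifts by
  \<open>\<plusminus>2p\<close>; the others, taken with signs, provide a point whose height is the
  whole width. This is what rules out imprimitive and parallel generators.\<close>

lemma covers4_parallel_generators:
  fixes u :: "'i \<Rightarrow> real^2"
  assumes "finite I" and p: "p \<in> int_lattice" "r \<in> int_lattice" "cr p r = 1"
    and len: "(\<Sum>i | i \<in> I \<and> cr p (u i) = 0. \<bar>cr (u i) r\<bar>) \<ge> 2"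
    and w: "(\<Sum>i\<in>I. \<bar>cr p (u i)\<bar>) \<ge> 2"
  shows "covers4 (bzon I u)"
proof -
  let ?S = "{i \<in> I. cr p (u i) = 0}"
  define h where "h = (\<Sum>i\<in>?S. \<bar>cr (u i) r\<bar>)"
  \<comment> \<open>The factor 2/h, at most 1, normalises the contribution of the parallel
    generators to exactly 2 in absolute value.\<close>
  define c where "c \<sigma> i = (if cr p (u i) = 0 then \<sigma> * (2 / h) * sgn (cr (u i) r) else sgn (cr p (u i)))" for \<sigma> i
  define y where "y = (\<Sum>i\<in>I. sgn (cr p (u i)) *\<^sub>R u i)"
  have h: "h \<ge> 2" using len by (simp add: h_def)
  have eq: "(\<Sum>i\<in>I. c \<sigma> i *\<^sub>R u i) = y + (2 * \<sigma>) *\<^sub>R p" for \<sigma>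
  proof -
    have "(\<Sum>i\<in>I. c \<sigma> i *\<^sub>R u i) = y + (\<Sum>i\<in>I. if cr p (u i) = 0 then (\<sigma> * (2 / h) * sgn (cr (u i) r)) *\<^sub>R u i else 0)"
      unfolding y_def sum.distrib[symmetric] by (intro sum.cong) (auto simp: c_def)
    also have "(\<Sum>i\<in>I. if cr p (u i) = 0 then (\<sigma> * (2 / h) * sgn (cr (u i) r)) *\<^sub>R u i else 0)
        = (\<Sum>i\<in>?S. (\<sigma> * (2 / h) * sgn (cr (u i) r)) *\<^sub>R u i)"
      by (rule sum.inter_filter[OF assms(1), symmetric])
    also have "\<dots> = (\<Sum>i\<in>?S. (\<sigma> * (2 / h) * \<bar>cr (u i) r\<bar>) *\<^sub>R p)"
    proof (intro sum.cong refl)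
      fix i assume "i \<in> ?S"
      then have "u i = cr (u i) r *\<^sub>R p" using cr_expand[OF p(3), of "u i"] by simp
      then have "(\<sigma> * (2 / h) * sgn (cr (u i) r)) *\<^sub>R u i = (\<sigma> * (2 / h) * sgn (cr (u i) r)) *\<^sub>R (cr (u i) r *\<^sub>R p)"
        by simp
      also have "\<dots> = (\<sigma> * (2 / h) * \<bar>cr (u i) r\<bar>) *\<^sub>R p"
        by (simp add: mult.assoc) (simp add: sgn_mult_self_eq abs_sgn mult.commute)
      finally show "(\<sigma> * (2 / h) * sgn (cr (u i) r)) *\<^sub>R u i = (\<sigma> * (2 / h) * \<bar>cr (u i) r\<bar>) *\<^sub>R p" .
    qed
    also have "\<dots> = (\<sigma> * (2 / h) * h) *\<^sub>R p"
      unfolding h_def by (simp only: sum_distrib_left scaleR_sum_left)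
    finally show ?thesis using h by (simp add: mult.commute)
  qed
  have "\<bar>c \<sigma> i\<bar> \<le> 1" if "\<bar>\<sigma>\<bar> = 1" for \<sigma> i
    using h that by (auto simp: c_def abs_mult sgn_if)
  then have mem: "y + (2 * \<sigma>) *\<^sub>R p \<in> bzon I u" if "\<bar>\<sigma>\<bar> = 1" for \<sigma>
    unfolding bzon_def eq[symmetric] using that by blast
  show ?thesis
  proof (rule covers4_parallelogram[OF p(1,2) _ convex_bzon bzon_minus])
    show "y + 2 *\<^sub>R p \<in> bzon I u" "y - 2 *\<^sub>R p \<in> bzon I u" using mem[of 1] mem[of "-1"] by simp_all
    have "cr p y = (\<Sum>i\<in>I. \<bar>cr p (u i)\<bar>)" unfolding y_def cr_sum
      by (intro sum.cong) (auto simp: abs_sgn mult.commute)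
    then show "\<bar>cr p y\<bar> \<ge> 2" using w by simp
  qed (use p in auto)
qed

text \<open>The chord direction is \<open>p = (k v - j u) / m\<close> with \<open>j = k a - h m\<close>.\<close>

lemma covers4_pair:
  fixes m a h k :: int
  assumes u: "u \<in> int_lattice" "r \<in> int_lattice" "cr u r = 1" and v: "v = of_int a *\<^sub>R u + of_int m *\<^sub>R r" "m > 0"
    and hk: "coprime h k" "k \<ge> 0" "2 * k \<le> m" "2 * \<bar>k * a - h * m\<bar> \<le> m"
      "2 * m + 4 * k * \<bar>k * a - h * m\<bar> \<le> (k + \<bar>k * a - h * m\<bar>) * m"
    and D: "convex D" "\<And>x. x \<in> D \<Longrightarrow> - x \<in> D"
      "\<And>a b. \<bar>a\<bar> \<le> 1 \<Longrightarrow> \<bar>b\<bar> \<le> 1 \<Longrightarrow> a *\<^sub>R u + b *\<^sub>R v \<in> D"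
  shows "covers4 D"
proof -
  define j where "j = k * a - h * m"
  define p where "p = of_int k *\<^sub>R r + of_int h *\<^sub>R u"
  obtain s t where st: "s * h + t * k = 1" using bezout_int[of h k] hk(1) by auto
  define r' where "r' = of_int s *\<^sub>R r - of_int t *\<^sub>R u"
  have ru: "cr r u = -1" using u(3) cr_commute[of r u] by simp
  have "cr p r' = real_of_int (s * h + t * k)" by (simp add: p_def r'_def u(3) ru algebra_simps)
  then have pr: "cr p r' = 1" using st by simp
  let ?m = "real_of_int m" and ?k = "real_of_int k" and ?j = "real_of_int j" and ?h = "real_of_int h"
  have rj: "?j = ?k * of_int a - ?h * ?m" by (simp add: j_def)
  have p2: "2 *\<^sub>R p = (- 2 * ?j / ?m) *\<^sub>R u + (2 * ?k / ?m) *\<^sub>R v"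
  proof -
    have "(- 2 * ?j / ?m) *\<^sub>R u + (2 * ?k / ?m) *\<^sub>R v
        = ((- 2 * ?j / ?m) + (2 * ?k / ?m) * of_int a) *\<^sub>R u + ((2 * ?k / ?m) * ?m) *\<^sub>R r"
      unfolding v(1) by (simp add: algebra_simps)
    also have "(2 * ?k / ?m) * ?m = 2 * ?k" using v(2) by simp
    also have "(- 2 * ?j / ?m) + (2 * ?k / ?m) * of_int a = 2 * ?h"
      unfolding rj using v(2) by (simp add: field_simps)
    finally show ?thesis by (simp add: p_def scaleR_add_right add.commute)
  qed
  define \<sigma> where "\<sigma> = (if j \<ge> 0 then 1 else - 1 :: real)"
  have sj: "\<sigma> * ?j = \<bar>?j\<bar>" "\<bar>\<sigma>\<bar> = 1" by (auto simp: \<sigma>_def)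
  \<comment> \<open>Each coefficient leaves just enough room for adding or subtracting
    \<open>2p\<close>. The sign \<open>\<sigma>\<close> makes both generators contribute to the
    height with the same sign; the last inequality of \<open>hk\<close> says that this height is at
    least 2.\<close>
  define al where "al = 1 - 2 * \<bar>?j\<bar> / ?m"
  define be where "be = \<sigma> * (1 - 2 * ?k / ?m)"
  define y where "y = al *\<^sub>R u + be *\<^sub>R v"
  have m0: "?m > 0" using v(2) by simp
  have "real_of_int (2 * k) \<le> ?m" "real_of_int (2 * \<bar>j\<bar>) \<le> ?m" using hk(3,4) unfolding j_def[symmetric] by (simp_all only: of_int_le_iff)
  then have small: "0 \<le> 2 * ?k / ?m" "2 * ?k / ?m \<le> 1" "0 \<le> 2 * \<bar>?j\<bar> / ?m" "2 * \<bar>?j\<bar> / ?m \<le> 1"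
    using m0 hk(2) by simp_all
  have al: "\<bar>al + 2 * ?j / ?m\<bar> \<le> 1" "\<bar>al - 2 * ?j / ?m\<bar> \<le> 1"
    using small(3,4) unfolding al_def by (cases "?j \<ge> 0"; simp add: abs_le_iff)+
  have be: "\<bar>be + 2 * ?k / ?m\<bar> \<le> 1" "\<bar>be - 2 * ?k / ?m\<bar> \<le> 1"
    using small(1,2) unfolding be_def \<sigma>_def by (auto simp: abs_le_iff)
  show ?thesis
  proof (rule covers4_parallelogram[of p r' D y])
    show "p \<in> int_lattice" "r' \<in> int_lattice" using u(1,2) unfolding p_def r'_def
      by (auto intro!: int_lattice_add int_lattice_diff int_lattice_scale)
    show "\<bar>cr p r'\<bar> = 1" using pr by simp
    have "y + 2 *\<^sub>R p = (al - 2 * ?j / ?m) *\<^sub>R u + (be + 2 * ?k / ?m) *\<^sub>R v"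
      unfolding p2 y_def by (simp add: algebra_simps)
    then show "y + 2 *\<^sub>R p \<in> D" using D(3) al be by simp
    have "y - 2 *\<^sub>R p = (al + 2 * ?j / ?m) *\<^sub>R u + (be - 2 * ?k / ?m) *\<^sub>R v"
      unfolding p2 y_def by (simp add: algebra_simps)
    then show "y - 2 *\<^sub>R p \<in> D" using D(3) al be by simp
    have cpv: "cr p v = - ?j" unfolding p_def v(1) rj by (simp add: ru u(3) algebra_simps)
    have cpu: "cr p u = - ?k" unfolding p_def by (simp add: ru)
    have "cr p y = - (?k + \<bar>?j\<bar> - 4 * ?k * \<bar>?j\<bar> / ?m)"
    proof -
      have "be * ?j = \<bar>?j\<bar> * (1 - 2 * ?k / ?m)" using sj(1) by (simp add: be_def algebra_simps)
      moreover have "cr p y = - (al * ?k) - be * ?j" unfolding y_def by (simp add: cpv cpu)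
      ultimately show ?thesis unfolding al_def using m0 by (simp add: field_simps)
    qed
    moreover have "real_of_int (2 * m + 4 * k * \<bar>j\<bar>) \<le> real_of_int ((k + \<bar>j\<bar>) * m)"
      using hk(5) unfolding j_def[symmetric] by (simp only: of_int_le_iff)
    then have "2 \<le> ?k + \<bar>?j\<bar> - 4 * ?k * \<bar>?j\<bar> / ?m" using m0 by (simp add: field_simps)
    ultimately show "2 \<le> \<bar>cr p y\<bar>" by simp
  qed (use D in auto)
qed

text \<open>Dirichlet's theorem gives \<open>k\<close> and \<open>j\<close> of order \<open>sqrt m\<close> with \<open>k \<bar>j\<bar> < m\<close>; the congruence hypotheses exclude
  \<open>k = \<bar>j\<bar> = 1\<close>. For \<open>m = 5\<close> the parallelogram is \<open>P_2_5\<close>.\<close>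

lemma covers4_thick_pair:
  fixes m a :: int
  assumes u: "u \<in> int_lattice" "r \<in> int_lattice" "cr u r = 1" and v: "v = of_int a *\<^sub>R u + of_int m *\<^sub>R r" "m > 0"
    and am: "coprime a m" "\<not> m dvd a - 1" "\<not> m dvd a + 1" "m \<noteq> 5"
    and D: "convex D" "\<And>x. x \<in> D \<Longrightarrow> - x \<in> D"
      "\<And>a b. \<bar>a\<bar> \<le> 1 \<Longrightarrow> \<bar>b\<bar> \<le> 1 \<Longrightarrow> a *\<^sub>R u + b *\<^sub>R v \<in> D"
  shows "covers4 D"
proof -
  note pair = covers4_pair[OF u v _ _ _ _ _ D]
  consider "m \<ge> 8" | "m = 7" | "m \<le> 6" by linarith
  then show ?thesis
  proof cases
    case 1
    \<comment> \<open>With \<open>N\<close> about sqrt m, Dirichlet bounds \<open>k\<close> by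
      \<open>N\<close> and makes \<open>j\<close> smaller than m/N in absolute value.\<close>
    define N where "N = nat \<lceil>sqrt m\<rceil>"
    have s0: "sqrt m > 0" using 1 by simp
    have N: "N > 0" "real N \<ge> sqrt m" "real N < sqrt m + 1" using s0 unfolding N_def by linarith+
    obtain h k where hk: "coprime h k" "0 < k" "k \<le> int N" "\<bar>of_int k * (real_of_int a / m) - of_int h\<bar> < 1 / N"
      using Dirichlet_approx_coprime[OF N(1)] by blast
    define j where "j = k * a - h * m"
    have m0: "real_of_int m > 0" using 1 by simp
    have "real_of_int j = m * (of_int k * (real_of_int a / m) - of_int h)"
      using m0 by (simp add: j_def field_simps)
    then have "\<bar>real_of_int j\<bar> = m * \<bar>of_int k * (real_of_int a / m) - of_int h\<bar>"
      using m0 by (simp only: abs_mult abs_of_pos)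
    then have jN: "\<bar>real_of_int j\<bar> < m / N" using hk(4) m0 by (simp add: mult.commute divide_simps split: if_splits)
    have "real_of_int k * \<bar>real_of_int j\<bar> \<le> N * \<bar>real_of_int j\<bar>" using hk(3) by (intro mult_right_mono) auto
    also have "\<dots> < m" using jN N(1) by (simp add: field_simps)
    finally have "real_of_int (k * \<bar>j\<bar>) < m" by simp
    then have kj: "k * \<bar>j\<bar> < m" by linarith
    have "m / N \<le> m / sqrt m" 
    proof (rule divide_left_mono[OF N(2)])
      have "real N > 0" using N(2) s0 by linarith
      then show "0 < real N * sqrt m" using s0 by (rule mult_pos_pos)
    qed (use m0 in simp)
    also have "\<dots> = sqrt m" using m0 by (simp add: real_div_sqrt)
    finally have js: "\<bar>real_of_int j\<bar> < sqrt m" using jN by linarith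
    \<comment> \<open>Equivalent to m^2 - 6m + 1 >= 0; it puts both \<open>2k\<close> and twice the
      absolute value of \<open>j\<close> below the limit \<open>m\<close>.\<close>
    have sq: "sqrt m \<le> (real_of_int m - 1) / 2"
    proof (rule real_le_lsqrt)
      have "0 \<le> (real_of_int m - 8) * (real_of_int m + 2) + 17" using 1 by simp
      then show "real_of_int m \<le> ((real_of_int m - 1) / 2)\<^sup>2"
        by (simp add: power2_eq_square field_simps)
    qed (use 1 in simp)
    then have sq: "2 * sqrt m \<le> real_of_int m - 1" by argo
    have k2: "2 * k \<le> m"
    proof -
      have "real_of_int k \<le> N" using hk(3) by linarith
      then have "2 * real_of_int k < real_of_int m + 1" using N(3) sq by linarith
      then show ?thesis by linarith
    qed
    have j2: "2 * \<bar>j\<bar> \<le> m" using js sq by linarith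
    have j0: "j \<noteq> 0"
    proof
      assume "j = 0"
      then have "m dvd k * a" by (simp add: j_def)
      then have "m dvd k" using am(1) by (simp add: coprime_commute coprime_dvd_mult_left_iff)
      then show False using hk(2) k2 by (auto dest: zdvd_imp_le)
    qed
    have kj1: "\<not> (k = 1 \<and> \<bar>j\<bar> = 1)"
    proof
      assume "k = 1 \<and> \<bar>j\<bar> = 1"
      then have "a - 1 = m * h \<or> a + 1 = m * h" unfolding j_def by (auto simp: algebra_simps abs_if split: if_splits)
      then show False using am(2,3) by (metis dvd_triv_left)
    qed
    \<comment> \<open>If the two sizes add up to at least 6, the product bound \<open>kj\<close>
      gives \<open>6m\<close>. The remaining pairs are finitely many; the tight ones, such as sizes
      1 and 2, need exactly m >= 8.\<close>
    have "2 * m + 4 * k * \<bar>j\<bar> \<le> (k + \<bar>j\<bar>) * m"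
    proof (cases "k + \<bar>j\<bar> \<ge> 6")
      case True
      have "2 * m + 4 * k * \<bar>j\<bar> \<le> 6 * m" using kj by simp
      also have "\<dots> \<le> (k + \<bar>j\<bar>) * m" using True 1 by (intro mult_right_mono) auto
      finally show ?thesis .
    next
      case False
      have "\<bar>j\<bar> \<ge> 1" using j0 by simp
      then have "(k = 1 \<and> \<bar>j\<bar> = 2) \<or> (k = 1 \<and> \<bar>j\<bar> = 3) \<or> (k = 1 \<and> \<bar>j\<bar> = 4) \<or> (k = 2 \<and> \<bar>j\<bar> = 1)
        \<or> (k = 2 \<and> \<bar>j\<bar> = 2) \<or> (k = 2 \<and> \<bar>j\<bar> = 3) \<or> (k = 3 \<and> \<bar>j\<bar> = 1) \<or> (k = 3 \<and> \<bar>j\<bar> = 2) \<or> (k = 4 \<and> \<bar>j\<bar> = 1)"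
        using False kj1 hk(2) by presburger
      then show ?thesis using 1 by (elim disjE) auto
    qed
    then show ?thesis using hk(1,2) k2 j2 unfolding j_def by (intro pair[of h k]) auto
  next
    case 2
    have split: "a = a mod 7 + 7 * (a div 7)" by simp
    have "a mod 7 \<noteq> 0" using am(1) 2 coprime_common_divisor[of a m 7] by auto
    moreover have "a mod 7 \<noteq> 1" "a mod 7 \<noteq> 6" using am(2,3) 2 by presburger+
    moreover have "0 \<le> a mod 7" "a mod 7 < 7" by simp_all
    \<comment> \<open>For residues 2 and 5, sizes 1 and 2 for \<open>k\<close> and \<open>j\<close>
      just miss the required inequality, so sizes 3 and 1 are used; residues 3 and 4 allow sizes 1
      and 3.\<close>
    ultimately consider "a mod 7 = 2" | "a mod 7 = 3" | "a mod 7 = 4" | "a mod 7 = 5" by linarith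
    then show ?thesis
    proof cases
      case 1
      have e: "3 * a - (1 + 3 * (a div 7)) * 7 = -1" using split 1 by simp
      have "coprime (1 + 3 * (a div 7)) 3" by (rule coprimeI) (metis dvd_add_left_iff dvd_mult2)
      then show ?thesis using pair[of "1 + 3 * (a div 7)" 3] e 2 by simp
    next
      case 2
      have e: "1 * a - (a div 7) * 7 = 3" using split 2 by simp
      show ?thesis using pair[of "a div 7" 1] e \<open>m = 7\<close> by simp
    next
      case 3
      have e: "1 * a - (1 + a div 7) * 7 = -3" using split 3 by simp
      show ?thesis using pair[of "1 + a div 7" 1] e \<open>m = 7\<close> by simp
    next
      case 4
      have e: "3 * a - (2 + 3 * (a div 7)) * 7 = 1" using split 4 by simp
      have "coprime (2 + 3 * (a div 7)) 3"
      proof (rule coprimeI)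
        fix d assume "d dvd 2 + 3 * (a div 7)" "d dvd 3"
        then have "d dvd 3 * (1 + a div 7) - (2 + 3 * (a div 7))" by (intro dvd_diff dvd_mult2)
        then show "d dvd 1" by simp
      qed
      then show ?thesis using pair[of "2 + 3 * (a div 7)" 3] e \<open>m = 7\<close> by simp
    qed
  next
    case 3
    \<comment> \<open>These are the moduli whose only units are 1 and -1, contrary to the congruence
      hypotheses.\<close>
    then have "m = 1 \<or> m = 2 \<or> m = 3 \<or> m = 4 \<or> m = 6" using v(2) am(4) by linarith
    moreover have "\<not> d dvd a" if "d dvd m" "d > 1" for d
      using coprime_common_divisor[OF am(1) _ that(1)] that(2) by (auto simp: zdvd1_eq)
    then have "2 dvd m \<Longrightarrow> \<not> 2 dvd a" "3 dvd m \<Longrightarrow> \<not> 3 dvd a" by simp_all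
    ultimately have "m dvd a - 1 \<or> m dvd a + 1" by (elim disjE) (simp_all, presburger+)
    then show ?thesis using am by blast
  qed
qed

text \<open>Excludes a third generator beside \<open>P_2_5\<close>. In direction \<open>r\<close>
  the two given ones leave a height of only 7/5 after paying for \<open>2r\<close>. If
  \<open>w\<close> is not parallel to \<open>r\<close>, it adds at least 1 to the height; otherwise
  it pays for half of \<open>2r\<close>, and the height becomes 11/5.\<close>

lemma covers4_P_2_5_third:
  assumes u: "u \<in> int_lattice" "r \<in> int_lattice" "\<bar>cr u r\<bar> = 1" and v: "v = 2 *\<^sub>R u + 5 *\<^sub>R r"
    and w: "w \<in> int_lattice" "w \<noteq> 0"
    and D: "convex D" "\<And>x. x \<in> D \<Longrightarrow> - x \<in> D"
      "\<And>a b c. \<bar>a\<bar> \<le> 1 \<Longrightarrow> \<bar>b\<bar> \<le> 1 \<Longrightarrow> \<bar>c\<bar> \<le> 1 \<Longrightarrow> a *\<^sub>R u + b *\<^sub>R v + c *\<^sub>R w \<in> D"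
  shows "covers4 D"
proof -
  define e where "e = cr r u"
  have e: "\<bar>e\<bar> = 1" using u(3) cr_commute[of r u] by (simp add: e_def)
  have ru: "cr r u = e" "cr r v = 2 * e" by (simp_all add: e_def v)
  have p: "\<bar>cr r u\<bar> = 1" using e ru by simp
  show ?thesis
  proof (cases "cr r w = 0")
    case False
    define \<sigma> where "\<sigma> = sgn (cr r w) * e"
    have s: "\<bar>\<sigma>\<bar> = 1" using False e by (auto simp: \<sigma>_def abs_mult abs_sgn_eq)
    have "\<bar>cr r w\<bar> \<ge> 1" using cr_Ints[OF u(2) w(1)] False by (auto elim!: Ints_cases)
    moreover have "\<sigma> * cr r w = \<bar>cr r w\<bar> * e" by (simp add: \<sigma>_def abs_sgn mult.commute)
    ultimately have "\<bar>(7/5) * e + \<sigma> * cr r w\<bar> \<ge> 2"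
      using e by (cases "e = 1") (auto simp: abs_if split: if_splits)
    then have f: "\<bar>cr r ((1/5) *\<^sub>R u + (3/5) *\<^sub>R v + \<sigma> *\<^sub>R w)\<bar> \<ge> 2" by (simp add: ru)
    have "(1/5) *\<^sub>R u + (3/5) *\<^sub>R v + \<sigma> *\<^sub>R w + 2 *\<^sub>R r = (-3/5) *\<^sub>R u + 1 *\<^sub>R v + \<sigma> *\<^sub>R w"
      "(1/5) *\<^sub>R u + (3/5) *\<^sub>R v + \<sigma> *\<^sub>R w - 2 *\<^sub>R r = 1 *\<^sub>R u + (1/5) *\<^sub>R v + \<sigma> *\<^sub>R w"
      by (simp_all add: v vec_eq_iff field_simps)
    then show ?thesis using s f by (intro covers4_parallelogram[OF u(2,1) p D(1,2)]) (auto intro!: D(3) simp only:)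
  next
    case True
    define c where "c = cr w u * e"
    have ee: "e * e = 1" using e by (auto simp: abs_if split: if_splits)
    have "w = cr w (e *\<^sub>R u) *\<^sub>R r + cr r w *\<^sub>R (e *\<^sub>R u)"
      by (rule cr_expand) (simp add: ru ee)
    then have wr: "w = c *\<^sub>R r" using True by (simp add: c_def mult.commute)
    have "c \<noteq> 0" using wr w(2) by auto
    moreover have "c \<in> \<int>" unfolding c_def e_def using cr_Ints u w by (intro Ints_mult) auto
    ultimately have c1: "\<bar>c\<bar> \<ge> 1" by (auto elim!: Ints_cases)
    then have c2: "\<bar>1 / c\<bar> \<le> 1" "c \<noteq> 0" by (auto simp: divide_simps)
    have f: "\<bar>cr r ((3/5) *\<^sub>R u + (4/5) *\<^sub>R v)\<bar> \<ge> 2" using e by (simp add: ru abs_mult flip: distrib_right)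
    have "(3/5) *\<^sub>R u + (4/5) *\<^sub>R v + 2 *\<^sub>R r = (1/5) *\<^sub>R u + 1 *\<^sub>R v + (1 / c) *\<^sub>R w"
      "(3/5) *\<^sub>R u + (4/5) *\<^sub>R v - 2 *\<^sub>R r = 1 *\<^sub>R u + (3/5) *\<^sub>R v + (- (1 / c)) *\<^sub>R w"
      using c2 by (simp_all add: v wr vec_eq_iff field_simps)
    then show ?thesis using c2 f by (intro covers4_parallelogram[OF u(2,1) p D(1,2)]) (auto intro!: D(3) simp only: abs_minus_cancel)
  qed
qed

subsection \<open>Planar zonotopes: thin pairs of generators\<close>

text \<open>Use \<open>w\<close>, the difference of \<open>v\<close> and \<open>u\<close> divided by
  \<open>m\<close>, as chord direction: \<open>2w\<close> costs 2/m of each coefficient and leaves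
  height 2 - 4/m. The third generator makes up the deficit.\<close>

lemma covers4_thin_pair:
  assumes u: "u \<in> int_lattice" "w \<in> int_lattice" "\<bar>cr u w\<bar> = 1" and v: "v = u + m *\<^sub>R w" "m \<ge> 2"
    and q: "\<bar>cr w q\<bar> * m \<ge> 4"
    and D: "convex D" "\<And>x. x \<in> D \<Longrightarrow> - x \<in> D"
      "\<And>a b c. \<bar>a\<bar> \<le> 1 \<Longrightarrow> \<bar>b\<bar> \<le> 1 \<Longrightarrow> \<bar>c\<bar> \<le> 1 \<Longrightarrow> a *\<^sub>R u + b *\<^sub>R v + c *\<^sub>R q \<in> D"
  shows "covers4 D"
proof -
  define e where "e = cr w u"
  have e: "\<bar>e\<bar> = 1" using u(3) cr_commute[of w u] by (simp add: e_def)
  have wu: "cr w u = e" "cr w v = e" by (simp_all add: e_def v)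
  have p: "\<bar>cr w u\<bar> = 1" using e wu by simp
  define \<sigma> where "\<sigma> = sgn (cr w q) * e"
  have q0: "cr w q \<noteq> 0" using q by auto
  have s: "\<bar>\<sigma>\<bar> = 1" using q0 e by (auto simp: \<sigma>_def abs_mult abs_sgn_eq)
  define t where "t = 2 / m"
  have t: "0 < t" "t \<le> 1" "t * m = 2" using v(2) by (auto simp: t_def)
  have "\<bar>cr w q\<bar> \<ge> 2 * t" using q v(2) by (simp add: t_def field_simps)
  moreover have "\<sigma> * cr w q = \<bar>cr w q\<bar> * e" by (simp add: \<sigma>_def abs_sgn mult.commute)
  moreover have "\<bar>2 * (1 - t) * e + \<bar>cr w q\<bar> * e\<bar> = 2 * (1 - t) + \<bar>cr w q\<bar>"
    using e t by (cases "e = 1") (auto simp: abs_if algebra_simps split: if_splits)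
  ultimately have f: "\<bar>cr w ((1 - t) *\<^sub>R u + (1 - t) *\<^sub>R v + \<sigma> *\<^sub>R q)\<bar> \<ge> 2"
    by (simp add: wu algebra_simps)
  have w2: "2 *\<^sub>R w = t *\<^sub>R v - t *\<^sub>R u" using t(3) by (simp add: v scaleR_add_right)
  have "(1 - t) *\<^sub>R u + (1 - t) *\<^sub>R v + \<sigma> *\<^sub>R q + 2 *\<^sub>R w = (1 - 2 * t) *\<^sub>R u + 1 *\<^sub>R v + \<sigma> *\<^sub>R q"
    "(1 - t) *\<^sub>R u + (1 - t) *\<^sub>R v + \<sigma> *\<^sub>R q - 2 *\<^sub>R w = 1 *\<^sub>R u + (1 - 2 * t) *\<^sub>R v + \<sigma> *\<^sub>R q"
    unfolding w2 by (simp_all add: vec_eq_iff algebra_simps)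
  moreover have "\<bar>1 - 2 * t\<bar> \<le> 1" using t by (simp add: abs_le_iff)
  ultimately show ?thesis using s f
    by (intro covers4_parallelogram[OF u(2,1) p D(1,2)]) (auto intro!: D(3) simp only: abs_one order_refl)
qed

text \<open>A generator along \<open>w\<close> pays for half of \<open>2w\<close>, so
  \<open>u\<close> and \<open>v\<close> lose only 1/m each. The height deficit is then at most 1,
  which \<open>q\<close> always compensates.\<close>

lemma covers4_thin_pair_parallel:
  assumes u: "u \<in> int_lattice" "w \<in> int_lattice" "\<bar>cr u w\<bar> = 1" and v: "v = u + m *\<^sub>R w" "m \<ge> 2"
    and q: "\<bar>cr w q\<bar> \<ge> 1" and w': "w' = b *\<^sub>R w" "\<bar>b\<bar> \<ge> 1"
    and D: "convex D" "\<And>x. x \<in> D \<Longrightarrow> - x \<in> D"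
      "\<And>a b c d. \<bar>a\<bar> \<le> 1 \<Longrightarrow> \<bar>b\<bar> \<le> 1 \<Longrightarrow> \<bar>c\<bar> \<le> 1 \<Longrightarrow> \<bar>d\<bar> \<le> 1
        \<Longrightarrow> a *\<^sub>R u + b *\<^sub>R v + c *\<^sub>R q + d *\<^sub>R w' \<in> D"
  shows "covers4 D"
proof -
  define e where "e = cr w u"
  have e: "\<bar>e\<bar> = 1" using u(3) cr_commute[of w u] by (simp add: e_def)
  have wu: "cr w u = e" "cr w v = e" by (simp_all add: e_def v)
  have p: "\<bar>cr w u\<bar> = 1" using e wu by simp
  define \<sigma> where "\<sigma> = sgn (cr w q) * e"
  have q0: "cr w q \<noteq> 0" using q by auto
  have s: "\<bar>\<sigma>\<bar> = 1" using q0 e by (auto simp: \<sigma>_def abs_mult abs_sgn_eq)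
  define t where "t = 1 / m"
  have t: "0 < t" "2 * t \<le> 1" "t * m = 1" using v(2) by (auto simp: t_def)
  have "\<sigma> * cr w q = \<bar>cr w q\<bar> * e" by (simp add: \<sigma>_def abs_sgn mult.commute)
  moreover have "\<bar>2 * (1 - t) * e + \<bar>cr w q\<bar> * e\<bar> = 2 * (1 - t) + \<bar>cr w q\<bar>"
    using e t by (cases "e = 1") (auto simp: abs_if algebra_simps split: if_splits)
  ultimately have f: "\<bar>cr w ((1 - t) *\<^sub>R u + (1 - t) *\<^sub>R v + \<sigma> *\<^sub>R q)\<bar> \<ge> 2"
    using t q by (simp add: wu algebra_simps)
  have b: "b \<noteq> 0" "\<bar>1 / b\<bar> \<le> 1" using w'(2) by (auto simp: divide_simps)
  have w2: "2 *\<^sub>R w = t *\<^sub>R v - t *\<^sub>R u + (1 / b) *\<^sub>R w'"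
    using t(3) b by (simp add: v w' scaleR_add_right scaleR_2)
  have "(1 - t) *\<^sub>R u + (1 - t) *\<^sub>R v + \<sigma> *\<^sub>R q + 2 *\<^sub>R w = (1 - 2 * t) *\<^sub>R u + 1 *\<^sub>R v + \<sigma> *\<^sub>R q + (1 / b) *\<^sub>R w'"
    "(1 - t) *\<^sub>R u + (1 - t) *\<^sub>R v + \<sigma> *\<^sub>R q - 2 *\<^sub>R w = 1 *\<^sub>R u + (1 - 2 * t) *\<^sub>R v + \<sigma> *\<^sub>R q + (- (1 / b)) *\<^sub>R w'"
    unfolding w2 by (simp_all add: vec_eq_iff algebra_simps)
  moreover have "\<bar>1 - 2 * t\<bar> \<le> 1" using t by (simp add: abs_le_iff)
  ultimately show ?thesis using s f b
    by (intro covers4_parallelogram[OF u(2,1) p D(1,2)])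
      (auto intro!: D(3) simp only: abs_one order_refl abs_minus_cancel)
qed

text \<open>No single chord direction suffices here, but in the coordinates \<open>x u + y w\<close> the fibres of the zonotope
  at \<open>x\<close> and \<open>x + 2\<close> together cover the circle of length two.\<close>

lemma covers4_thin_3:
  assumes u: "u \<in> int_lattice" "w \<in> int_lattice" "\<bar>cr u w\<bar> = 1" and v: "v = u + 3 *\<^sub>R w"
    and q: "q = u + b *\<^sub>R w" "b = 1 \<or> b = 2"
    and D: "\<And>a b c. \<bar>a\<bar> \<le> 1 \<Longrightarrow> \<bar>b\<bar> \<le> 1 \<Longrightarrow> \<bar>c\<bar> \<le> 1 \<Longrightarrow> a *\<^sub>R u + b *\<^sub>R v + c *\<^sub>R q \<in> D"
  shows "covers4 D"
  unfolding covers4_def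
proof
  fix X
  define e where "e = cr u w"
  have e: "e * e = 1" "e \<in> \<int>" using u(3) cr_Ints[OF u(1,2)] by (auto simp: e_def abs_if split: if_splits)
  \<comment> \<open>Undoes the centring: coefficients between 0 and 1, and covering modulo 2 instead
    of 4.\<close>
  define Y where "Y = (1/2) *\<^sub>R (X + u + v + q)"
  have red: "\<exists>l\<in>int_lattice. X - 4 *\<^sub>R l \<in> D"
    if l: "l \<in> int_lattice" "Y - 2 *\<^sub>R l = s1 *\<^sub>R u + s2 *\<^sub>R v + s3 *\<^sub>R q"
      and s: "0 \<le> s1" "s1 \<le> 1" "0 \<le> s2" "s2 \<le> 1" "0 \<le> s3" "s3 \<le> 1" for l s1 s2 s3
  proof -
    have "X - 4 *\<^sub>R l = 2 *\<^sub>R (Y - 2 *\<^sub>R l) - u - v - q"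
      by (simp add: Y_def vec_eq_iff field_simps)
    also have "\<dots> = (2 * s1 - 1) *\<^sub>R u + (2 * s2 - 1) *\<^sub>R v + (2 * s3 - 1) *\<^sub>R q"
      unfolding l(2) by (simp add: vec_eq_iff algebra_simps)
    also have "\<dots> \<in> D" using s by (intro D) (auto simp: abs_le_iff)
    finally show ?thesis using l(1) by blast
  qed
  define x0 where "x0 = cr Y (e *\<^sub>R w)"
  define y0 where "y0 = e * cr u Y"
  have "Y = cr Y (e *\<^sub>R w) *\<^sub>R u + cr u Y *\<^sub>R (e *\<^sub>R w)"
    by (rule cr_expand) (use e in \<open>simp add: e_def\<close>)
  then have Y: "Y = x0 *\<^sub>R u + y0 *\<^sub>R w" by (simp add: x0_def y0_def mult.commute)
  define k where "k = (of_int \<lfloor>x0 / 2\<rfloor> :: real)"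
  define x where "x = x0 - 2 * k"
  have "k \<le> x0 / 2" "x0 / 2 < k + 1" unfolding k_def by linarith+
  then have x: "0 \<le> x" "x < 2" unfolding x_def by auto
  have kI: "k \<in> \<int>" by (simp add: k_def)
  have lat: "a *\<^sub>R u + c *\<^sub>R w \<in> int_lattice" if "a \<in> \<int>" "c \<in> \<int>" for a c
    using that u(1,2) by (intro int_lattice_add int_lattice_scale)
  have step: "\<exists>l\<in>int_lattice. X - 4 *\<^sub>R l \<in> D"
    if "a \<in> \<int>" "c \<in> \<int>" "x0 - 2 * a = s1 + s2 + s3" "y0 - 2 * c = 3 * s2 + b * s3"
      and s: "0 \<le> s1" "s1 \<le> 1" "0 \<le> s2" "s2 \<le> 1" "0 \<le> s3" "s3 \<le> 1" for a c s1 s2 s3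
  proof (rule red[OF lat[OF that(1,2)] _ s])
    have "Y - 2 *\<^sub>R (a *\<^sub>R u + c *\<^sub>R w) = (x0 - 2 * a) *\<^sub>R u + (y0 - 2 * c) *\<^sub>R w"
      by (simp add: Y algebra_simps)
    also have "\<dots> = s1 *\<^sub>R u + s2 *\<^sub>R v + s3 *\<^sub>R q" unfolding that(3,4) v q(1) by (simp add: algebra_simps)
    finally show "Y - 2 *\<^sub>R (a *\<^sub>R u + c *\<^sub>R w) = s1 *\<^sub>R u + s2 *\<^sub>R v + s3 *\<^sub>R q" .
  qed
  show "\<exists>l\<in>int_lattice. X - 4 *\<^sub>R l \<in> D"
  proof (cases "x \<le> 1")
    case True
    define j where "j = (of_int \<lfloor>y0 / 2\<rfloor> :: real)"
    define y where "y = y0 - 2 * j"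
    have "j \<le> y0 / 2" "y0 / 2 < j + 1" unfolding j_def by linarith+
    then have y: "0 \<le> y" "y < 2" unfolding y_def by auto
    have jI: "j \<in> \<int>" by (simp add: j_def)
    have xe: "x0 - 2 * k = x" "y0 - 2 * j = y" "x0 - 2 * (k - 1) = x + 2" "y0 - 2 * (j - 1) = y + 2"
      by (simp_all add: x_def y_def)
    show ?thesis
    \<comment> \<open>For x <= 1 the fibre at \<open>x\<close> is the interval from 0 to
      \<open>3x\<close>, and the one at \<open>x + 2\<close> runs from \<open>3x + b\<close> to
      \<open>3 + b\<close>. A \<open>y\<close> between \<open>3x\<close> and 2 falls into the second
      after a shift by 2, because \<open>b\<close> is 1 or 2.\<close>
    proof (cases "y \<le> 3 * x")
      case le: True
      show ?thesis
        by (rule step[of k j "x - y / 3" "y / 3" 0]) (use kI jI x y le True xe in simp_all)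
    next
      case False
      have kj: "k - 1 \<in> \<int>" "j - 1 \<in> \<int>" using kI jI by auto
      show ?thesis using q(2)
      proof
        assume "b = 1"
        then show ?thesis
          by (intro step[of "k - 1" "j - 1" "1 + x - (y + 1) / 3" "(y + 1) / 3" 1])
            (use kj x y False True xe in simp_all)
      next
        assume "b = 2"
        then show ?thesis
          by (intro step[of "k - 1" "j - 1" "1 + x - y / 3" "y / 3" 1])
            (use kj x y False True xe in simp_all)
      qed
    qed
  next
    case False
    \<comment> \<open>For x > 1 the fibre at \<open>x\<close> contains an interval of length 3
      starting at \<open>b * (x - 1)\<close>, longer than one period.\<close>
    define j where "j = (of_int \<lfloor>(y0 - b * (x - 1)) / 2\<rfloor> :: real)"
    define y where "y = y0 - 2 * j - b * (x - 1)"
    have "j \<le> (y0 - b * (x - 1)) / 2" "(y0 - b * (x - 1)) / 2 < j + 1" unfolding j_def by linarith+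
    then have y: "0 \<le> y" "y < 2" unfolding y_def by auto
    have jI: "j \<in> \<int>" by (simp add: j_def)
    have xe: "x0 - 2 * k = x" "y0 - 2 * j = y + b * (x - 1)" by (simp_all add: x_def y_def)
    show ?thesis
      by (rule step[of k j "1 - y / 3" "y / 3" "x - 1"]) (use kI jI x y False xe in simp_all)
  qed
qed

lemma Ints_le_1: "x \<in> \<int> \<Longrightarrow> x \<noteq> 0 \<Longrightarrow> \<bar>x\<bar> \<ge> (1::real)"
  by (auto elim!: Ints_cases)

text \<open>If covering fails, the nonzero generators are primitive and pairwise nonparallel, and (away from
  \<open>P_2_5\<close>) any two of them satisfy \<open>u j = \<plusminus>u i + m w\<close> with \<open>m\<close> their determinant. Taking a pair with
  maximal \<open>m\<close> leaves only a few possible positions for the other generators.\<close>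

theorem covers_half_or_P_2_5:
  fixes u :: "'i \<Rightarrow> real^2"
  assumes fin: "finite I" and int: "\<And>i. i \<in> I \<Longrightarrow> u i \<in> int_lattice"
    and width: "\<And>x. x \<in> int_lattice \<Longrightarrow> x \<noteq> 0 \<Longrightarrow> (\<Sum>i\<in>I. \<bar>cr x (u i)\<bar>) \<ge> 3"
    and no: "\<not> covers4 (bzon I u)"
  obtains i j e r where "i \<in> I" "j \<in> I" "i \<noteq> j" "\<And>k. k \<in> I \<Longrightarrow> k \<noteq> i \<Longrightarrow> k \<noteq> j \<Longrightarrow> u k = 0"
    "e \<in> int_lattice" "r \<in> int_lattice" "\<bar>cr e r\<bar> = 1" "u i = e \<or> u i = - e" "u j = 2 *\<^sub>R e + 5 *\<^sub>R r"
proof -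
  note result = that
  let ?D = "bzon I u"
  note D = convex_bzon[of I u] bzon_minus[of _ I u]
  define N where "N = {i \<in> I. u i \<noteq> 0}"
  have N: "i \<in> I" "u i \<noteq> 0" "u i \<in> int_lattice" if "i \<in> N" for i using that int by (auto simp: N_def)
  \<comment> \<open>One bound for two purposes: a single imprimitive generator, or two parallel
    ones, would already have length 2 along \<open>p\<close>.\<close>
  have short: "(\<Sum>i | i \<in> I \<and> cr p (u i) = 0. \<bar>cr (u i) r\<bar>) < 2"
    if "p \<in> int_lattice" "r \<in> int_lattice" "cr p r = 1" for p r
  proof -
    have "p \<noteq> 0" using that(3) by auto
    then show ?thesis using covers4_parallel_generators[OF fin that] no width[OF that(1)] by force
  qed
  have prim: "\<exists>r\<in>int_lattice. cr (u i) r = 1" if iN: "i \<in> N" for i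
  proof -
    obtain g p r where g: "g \<ge> 1" "g \<in> \<int>" "u i = g *\<^sub>R p" "p \<in> int_lattice" "r \<in> int_lattice" "cr p r = 1"
      using primitive_2[OF N(3,2)[OF iN]] by metis
    have "g = \<bar>cr (u i) r\<bar>" using g by simp
    also have "\<dots> \<le> (\<Sum>i | i \<in> I \<and> cr p (u i) = 0. \<bar>cr (u i) r\<bar>)"
      using fin N(1)[OF iN] g(3) by (intro member_le_sum) auto
    also have "\<dots> < 2" using short g by blast
    finally have "g = 1" using g(1,2) by (auto elim!: Ints_cases)
    then show ?thesis using g by auto
  qed
  have nonpar: "cr (u i) (u j) \<noteq> 0" if ij: "i \<in> N" "j \<in> N" "i \<noteq> j" for i j
  proof
    assume c0: "cr (u i) (u j) = 0"
    obtain r where r: "r \<in> int_lattice" "cr (u i) r = 1" using prim[OF ij(1)] by blast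
    have "u j = cr (u j) r *\<^sub>R u i" using cr_expand[OF r(2), of "u j"] c0 by simp
    then have "cr (u j) r \<noteq> 0" using N(2)[OF ij(2)] by auto
    then have "\<bar>cr (u j) r\<bar> \<ge> 1" using cr_Ints[OF N(3)[OF ij(2)] r(1)] by (rule Ints_le_1[rotated])
    then have "2 \<le> (\<Sum>k\<in>{i, j}. \<bar>cr (u k) r\<bar>)" using ij(3) r(2) by simp
    also have "\<dots> \<le> (\<Sum>k | k \<in> I \<and> cr (u i) (u k) = 0. \<bar>cr (u k) r\<bar>)"
      using fin N(1) ij c0 by (intro sum_mono2) auto
    also have "\<dots> < 2" using short[OF N(3)[OF ij(1)] r] .
    finally show False by simp
  qed
  have mem3: "a *\<^sub>R u i + b *\<^sub>R u j + c *\<^sub>R u k \<in> ?D"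
    if "i \<in> N" "j \<in> N" "k \<in> N" "i \<noteq> j" "k \<noteq> i" "k \<noteq> j" "\<bar>a\<bar> \<le> 1" "\<bar>b\<bar> \<le> 1" "\<bar>c\<bar> \<le> 1" for i j k a b c
    using that N(1) by (intro bzon_3[OF fin]) auto
  \<comment> \<open>Assuming that \<open>thesis\<close> fails lets the \<open>P_2_5\<close> branch,
    which proves \<open>thesis\<close>, close itself inside this claim.\<close>
  have thin: "\<exists>\<epsilon> w. \<bar>\<epsilon>\<bar> = 1 \<and> w \<in> int_lattice \<and> u i + \<bar>cr (u i) (u j)\<bar> *\<^sub>R w = \<epsilon> *\<^sub>R u j"
    if ij: "i \<in> N" "j \<in> N" "i \<noteq> j"
      and notP: "\<not> thesis" for i j
  proof -
    obtain r where r: "r \<in> int_lattice" "cr (u i) r = 1" using prim[OF ij(1)] by blast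
    define \<tau> where "\<tau> = sgn (cr (u i) (u j))"
    have \<tau>: "\<bar>\<tau>\<bar> = 1" "\<tau> * \<tau> = 1" "\<tau> \<in> \<int>" using nonpar[OF ij] by (auto simp: \<tau>_def abs_sgn_eq sgn_if)
    define v where "v = \<tau> *\<^sub>R u j"
    have vI: "v \<in> int_lattice" using N(3)[OF ij(2)] \<tau>(3) by (simp add: v_def int_lattice_scale)
    have m: "cr (u i) v = \<bar>cr (u i) (u j)\<bar>" by (simp add: v_def \<tau>_def abs_sgn mult.commute)
    obtain a where a: "cr v r = of_int a" using cr_Ints[OF vI r(1)] by (auto elim: Ints_cases)
    obtain m' where m': "cr (u i) v = of_int m'" using cr_Ints[OF N(3)[OF ij(1)] vI] by (auto elim: Ints_cases)
    have "real_of_int m' > 0" using m m' nonpar[OF ij] by simp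
    then have mp: "m' > 0" by simp
    have v: "v = of_int a *\<^sub>R u i + of_int m' *\<^sub>R r" using cr_expand[OF r(2), of v] a m' by simp
    have memv: "b *\<^sub>R u i + c *\<^sub>R v \<in> ?D" if "\<bar>b\<bar> \<le> 1" "\<bar>c\<bar> \<le> 1" for b c
      using bzon_2[OF fin N(1)[OF ij(1)] N(1)[OF ij(2)] ij(3), of b "c * \<tau>" u] that \<tau>(1)
      by (simp add: v_def abs_mult)
    have cop: "coprime a m'"
    proof -
      obtain r2 where r2: "r2 \<in> int_lattice" "cr (u j) r2 = 1" using prim[OF ij(2)] by blast
      have 1: "cr v (\<tau> *\<^sub>R r2) = 1" using r2 \<tau> by (simp add: v_def)
      have "\<tau> *\<^sub>R r2 \<in> int_lattice" using r2 \<tau> by (intro int_lattice_scale)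
      then obtain s t where st: "cr (u i) (\<tau> *\<^sub>R r2) = of_int s" "cr r (\<tau> *\<^sub>R r2) = of_int t"
        using cr_Ints N(3)[OF ij(1)] r(1) by (meson Ints_cases)
      have "real_of_int (a * s + m' * t) = of_int a * cr (u i) (\<tau> *\<^sub>R r2) + of_int m' * cr r (\<tau> *\<^sub>R r2)"
        by (simp only: of_int_add of_int_mult st)
      also have "\<dots> = cr v (\<tau> *\<^sub>R r2)" by (simp add: v algebra_simps)
      finally have "real_of_int (a * s + m' * t) = 1" using 1 by simp
      then have "a * s + m' * t = 1" by linarith
      then show ?thesis by (intro coprimeI) (metis dvd_add dvd_mult2)
    qed
    show ?thesis
    \<comment> \<open>Residue 1 or -1 makes the pair thin. Any other residue covers, unless the
      determinant is 5, where only 2 and 3 remain.\<close>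
    proof (cases "m' dvd a - 1 \<or> m' dvd a + 1")
      case True
      then obtain \<epsilon> c where c: "a = \<epsilon> + m' * c" "\<epsilon> = 1 \<or> \<epsilon> = - 1"
        by (auto elim!: dvdE) (metis add_diff_cancel_left' diff_add_cancel minus_add_cancel uminus_add_conv_diff add.commute)+
      define w where "w = of_int \<epsilon> *\<^sub>R (of_int c *\<^sub>R u i + r)"
      have "(of_int \<epsilon> * \<tau>) *\<^sub>R u j = of_int \<epsilon> *\<^sub>R v" by (simp add: v_def)
      also have "\<dots> = u i + of_int m' *\<^sub>R w" unfolding v w_def c(1)
        using c(2) by (auto simp: algebra_simps)
      finally show ?thesis using m m' \<tau>(1) c(2) N(3)[OF ij(1)] r(1)
        by (intro exI[of _ "of_int \<epsilon> * \<tau>"] exI[of _ w])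
          (auto simp: w_def abs_mult intro!: int_lattice_add int_lattice_scale int_lattice_minus)
    next
      case False
      have "m' = 5"
        using covers4_thick_pair[OF N(3)[OF ij(1)] r v mp cop _ _ _ D memv] no False by blast
      have "a mod 5 = 2 \<or> a mod 5 = 3"
      proof -
        have "\<not> 5 dvd a" using cop \<open>m' = 5\<close> coprime_common_divisor[of a m' 5] by auto
        then show ?thesis using False \<open>m' = 5\<close> by presburger
      qed
      \<comment> \<open>Residue 3 is -2 modulo 5, so a sign change of the first generator normalises
        both cases to 2.\<close>
      then obtain \<epsilon> c where c: "\<epsilon> * a = 2 + 5 * c" "\<epsilon> = 1 \<or> \<epsilon> = - 1"
      proof
        assume "a mod 5 = 2"
        then show ?thesis using that[of 1 "a div 5"] mult_div_mod_eq[of 5 a] by simp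
      next
        assume "a mod 5 = 3"
        then show ?thesis using that[of "-1" "- (a div 5) - 1"] mult_div_mod_eq[of 5 a] by simp
      qed
      define e where "e = (\<tau> * of_int \<epsilon>) *\<^sub>R u i"
      define r' where "r' = \<tau> *\<^sub>R r + of_int c *\<^sub>R e"
      have eI: "e \<in> int_lattice" "r' \<in> int_lattice" using N(3)[OF ij(1)] r(1) \<tau>(3)
        by (auto simp: e_def r'_def intro!: int_lattice_add int_lattice_scale)
      have er: "\<bar>cr e r'\<bar> = 1" using r(2) \<tau>(1) c(2) by (auto simp: r'_def) (auto simp: e_def abs_mult)
      have ee: "u i = e \<or> u i = - e" using c(2) \<tau>(1) by (cases "\<tau> = 1") (auto simp: e_def abs_if split: if_splits)
      have ue: "u i = (\<tau> * of_int \<epsilon>) *\<^sub>R e" using c(2) \<tau>(2) by (auto simp: e_def)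
      have uj: "u j = 2 *\<^sub>R e + 5 *\<^sub>R r'"
      proof -
        have "u j = \<tau> *\<^sub>R v" using \<tau>(2) by (simp add: v_def)
        also have "\<dots> = (of_int (\<epsilon> * a)) *\<^sub>R e + (5 * \<tau>) *\<^sub>R r"
          unfolding v \<open>m' = 5\<close> using c(2) by (auto simp: e_def scaleR_add_right mult.commute)
        also have "\<dots> = 2 *\<^sub>R e + 5 *\<^sub>R r'" unfolding c(1) r'_def by (simp add: algebra_simps)
        finally show ?thesis .
      qed
      have "u k = 0" if k: "k \<in> I" "k \<noteq> i" "k \<noteq> j" for k
      proof (rule ccontr)
        assume "u k \<noteq> 0"
        then have kN: "k \<in> N" using k by (simp add: N_def)
        have "a *\<^sub>R e + b *\<^sub>R u j + c' *\<^sub>R u k \<in> ?D" if "\<bar>a\<bar> \<le> 1" "\<bar>b\<bar> \<le> 1" "\<bar>c'\<bar> \<le> 1" for a b c'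
        proof -
          have "\<bar>a * (\<tau> * of_int \<epsilon>)\<bar> \<le> 1" using that(1) \<tau>(1) c(2) by (auto simp: abs_mult)
          then show ?thesis using mem3[OF ij(1,2) kN ij(3) k(2,3) _ that(2,3), of "a * (\<tau> * of_int \<epsilon>)"]
            by (simp add: e_def)
        qed
        then show False using covers4_P_2_5_third[OF eI er uj N(3,2)[OF kN] D] no by blast
      qed
      then have thesis using result[of i j e r'] N(1) ij eI er ee uj by blast
      then show ?thesis using notP by blast
    qed
  qed
  show thesis
  proof (rule ccontr)
    assume notP: "\<not> thesis"
    \<comment> \<open>Width at least three as a source of generators: whenever those in
      \<open>F\<close> contribute less than 3 across \<open>x\<close>, another one is not parallel
      to \<open>x\<close>.\<close>
    have other: "\<exists>l\<in>N - F. cr x (u l) \<noteq> 0"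
      if "x \<in> int_lattice" "x \<noteq> 0" "F \<subseteq> N" "(\<Sum>i\<in>F. \<bar>cr x (u i)\<bar>) < 3" for x F
    proof (rule ccontr)
      assume "\<not> ?thesis"
      then have "(\<Sum>i\<in>I. \<bar>cr x (u i)\<bar>) = (\<Sum>i\<in>F. \<bar>cr x (u i)\<bar>)"
        using that(3) by (intro sum.mono_neutral_right fin) (auto simp: N_def)
      then show False using width[OF that(1,2)] that(4) by simp
    qed
    define P where "P = {(i, j). i \<in> N \<and> j \<in> N \<and> i \<noteq> j}"
    let ?f = "\<lambda>(i, j). \<bar>cr (u i) (u j)\<bar>"
    have "vector [1, 0] \<in> int_lattice - {0 :: real^2}" by (auto simp: int_lattice_def forall_2 vec_eq_iff)
    then obtain i0 where i0: "i0 \<in> N" using other[of "vector [1, 0]" "{}"] by auto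
    obtain j0 where "j0 \<in> N" "cr (u i0) (u j0) \<noteq> 0" using other[OF N(3,2)[OF i0], of "{}"] by auto
    then have "(i0, j0) \<in> P" using i0 by (auto simp: P_def)
    then have Pne: "P \<noteq> {}" by blast
    have "P \<subseteq> I \<times> I" using N(1) by (auto simp: P_def)
    then have Pfin: "finite P" using fin by (meson finite_SigmaI finite_subset)
    have "Max (?f ` P) \<in> ?f ` P" using Pne Pfin by (intro Max_in) auto
    then obtain i j where ij: "i \<in> N" "j \<in> N" "i \<noteq> j" "\<bar>cr (u i) (u j)\<bar> = Max (?f ` P)"
      by (auto simp: P_def)
    define m where "m = \<bar>cr (u i) (u j)\<bar>"
    have max: "\<bar>cr (u k) (u l)\<bar> \<le> m" if "k \<in> N" "l \<in> N" "k \<noteq> l" for k l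
      unfolding m_def ij(4) using that Pfin by (intro Max_ge) (auto simp: P_def intro!: rev_image_eqI[of "(k, l)"])
    define U where "U = u i"
    obtain \<epsilon> w where w: "\<bar>\<epsilon>\<bar> = 1" "w \<in> int_lattice" "U + m *\<^sub>R w = \<epsilon> *\<^sub>R u j"
      using thin[OF ij(1-3) notP] unfolding m_def U_def by blast
    define V where "V = U + m *\<^sub>R w"
    have Vj: "V = \<epsilon> *\<^sub>R u j" by (simp add: V_def w)
    have UI: "U \<in> int_lattice" using N(3)[OF ij(1)] by (simp add: U_def)
    have mI: "m \<in> \<int>" unfolding m_def using cr_Ints N(3) ij by (intro Ints_abs) auto
    have m1: "m \<ge> 1" unfolding m_def using Ints_le_1 cr_Ints N(3) nonpar ij by blast
    have "\<bar>cr U V\<bar> = m" using w(1) by (simp add: Vj U_def m_def abs_mult)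
    moreover have "\<bar>cr U V\<bar> = m * \<bar>cr U w\<bar>" using m1 by (simp add: V_def abs_mult)
    ultimately have Uw: "\<bar>cr U w\<bar> = 1" using m1 by simp
    have wU: "\<bar>cr w U\<bar> = 1" using Uw cr_commute[of w U] by simp
    have wV: "\<bar>cr w (u j)\<bar> = 1"
    proof -
      have "\<bar>cr w V\<bar> = 1" using wU by (simp add: V_def)
      then show ?thesis using w(1) by (simp add: Vj abs_mult)
    qed
    have w0: "w \<noteq> 0" using Uw by auto
    have mem: "a *\<^sub>R U + b *\<^sub>R V + c *\<^sub>R u k \<in> ?D"
      if "k \<in> N" "k \<noteq> i" "k \<noteq> j" "\<bar>a\<bar> \<le> 1" "\<bar>b\<bar> \<le> 1" "\<bar>c\<bar> \<le> 1" for k a b c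
      using mem3[OF ij(1,2) that(1) ij(3) that(2,3), of a "b * \<epsilon>" c] that(4-) w(1)
      by (simp add: U_def Vj abs_mult)
    have crV: "cr V x = cr U x + m * cr w x" for x by (simp add: V_def)
    have bd: "cr U (u k) \<noteq> 0" "cr V (u k) \<noteq> 0" "\<bar>cr U (u k)\<bar> \<le> m" "\<bar>cr V (u k)\<bar> \<le> m"
      if "k \<in> N" "k \<noteq> i" "k \<noteq> j" for k
      using that nonpar[OF ij(1) that(1)] nonpar[OF ij(2) that(1)] max[OF ij(1) that(1)] max[OF ij(2) that(1)] w(1)
      by (auto simp: U_def Vj abs_mult)
    have small: "\<bar>cr w (u k)\<bar> * m < 4" if "m \<ge> 2" "k \<in> N" "k \<noteq> i" "k \<noteq> j" for k
      using covers4_thin_pair[OF UI w(2) Uw V_def that(1) _ D mem[OF that(2-4)]] no by force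
    \<comment> \<open>Beside a generator transverse to \<open>w\<close>, one parallel to
      \<open>w\<close> would produce a covering.\<close>
    have noL: "cr w (u l) \<noteq> 0" if "m \<ge> 2" "k \<in> N" "k \<noteq> i" "k \<noteq> j" "cr w (u k) \<noteq> 0"
      "l \<in> N" "l \<noteq> i" "l \<noteq> j" "l \<noteq> k" for k l
    proof
      assume l0: "cr w (u l) = 0"
      define b where "b = cr (u l) (cr w U *\<^sub>R U)"
      have "cr w (cr w U *\<^sub>R U) = 1" using wU by (auto simp: abs_if split: if_splits)
      from cr_expand[OF this, of "u l"] have ul: "u l = b *\<^sub>R w" using l0 by (simp add: b_def)
      have "b \<in> \<int>" unfolding b_def by (intro cr_Ints int_lattice_scale UI w(2) N(3) that)
      moreover have "b \<noteq> 0" using ul N(2)[OF that(6)] by auto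
      ultimately have b1: "\<bar>b\<bar> \<ge> 1" by (rule Ints_le_1)
      have k1: "\<bar>cr w (u k)\<bar> \<ge> 1" by (intro Ints_le_1 cr_Ints w(2) N(3) that)
      have "a *\<^sub>R U + b *\<^sub>R V + c *\<^sub>R u k + d *\<^sub>R u l \<in> ?D"
        if "\<bar>a\<bar> \<le> 1" "\<bar>b\<bar> \<le> 1" "\<bar>c\<bar> \<le> 1" "\<bar>d\<bar> \<le> 1" for a b c d
        using bzon_4[OF fin N(1)[OF ij(1)] N(1)[OF ij(2)] N(1)[OF \<open>k \<in> N\<close>] N(1)[OF \<open>l \<in> N\<close>], of a "b * \<epsilon>" c d u]
          that ij(3) w(1) \<open>k \<noteq> i\<close> \<open>k \<noteq> j\<close> \<open>l \<noteq> i\<close> \<open>l \<noteq> j\<close> \<open>l \<noteq> k\<close>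
        by (simp add: U_def Vj abs_mult)
      then show False using covers4_thin_pair_parallel[OF UI w(2) Uw V_def that(1) k1 ul b1 D] no by blast
    qed
    \<comment> \<open>Across \<open>w\<close> the chosen pair contributes only 1 + 1.\<close>
    obtain k where k: "k \<in> N" "k \<noteq> i" "k \<noteq> j" "cr w (u k) \<noteq> 0"
      using other[OF w(2) w0, of "{i, j}"] ij wU wV by (auto simp: U_def)
    define q where "q = u k"
    have q: "q \<in> int_lattice" "q \<noteq> 0" using N(3,2)[OF k(1)] by (auto simp: q_def)
    have ints: "\<exists>s t. cr w (u l) = of_int s \<and> cr U (u l) = of_int t" if "l \<in> N" for l
      using cr_Ints[OF w(2) N(3)[OF that]] cr_Ints[OF UI N(3)[OF that]] by (auto elim!: Ints_cases)
    obtain M where M: "m = of_int M" using mI by (auto elim: Ints_cases)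
    \<comment> \<open>Nonparallelism and the maximality of \<open>M\<close>, in integer coordinates:
      \<open>t\<close> and \<open>t + M * s\<close> are the determinants of \<open>U\<close> and
      \<open>V\<close> with \<open>u l\<close>.\<close>
    have st: "t \<noteq> 0 \<and> t + M * s \<noteq> 0 \<and> \<bar>t\<bar> \<le> M \<and> \<bar>t + M * s\<bar> \<le> M"
      if "l \<in> N" "l \<noteq> i" "l \<noteq> j" "cr w (u l) = of_int s" "cr U (u l) = of_int t" for l s t
    proof -
      have "cr V (u l) = of_int (t + M * s)" using crV[of "u l"] that(4,5) M by simp
      then show ?thesis using bd[OF that(1-3)] that(5) M
        by (simp only: of_int_eq_0_iff flip: of_int_abs) (simp only: of_int_le_iff of_int_eq_0_iff, simp)
    qed
    obtain s t where stk: "cr w q = of_int s" "cr U q = of_int t" using ints[OF k(1)] by (auto simp: q_def)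
    have sk: "s \<noteq> 0" "t \<noteq> 0" "t + M * s \<noteq> 0" "\<bar>t\<bar> \<le> M" "\<bar>t + M * s\<bar> \<le> M"
      using st[OF k(1-3), of s t] stk k(4) by (auto simp: q_def)
    have M1: "M \<ge> 1" using m1 M by simp
    \<comment> \<open>A Pluecker relation; it computes the determinant of two further generators
      from their coordinates \<open>s\<close> and \<open>t\<close>.\<close>
    have pl: "cr U w * cr q x = cr U q * cr w x - cr U x * cr w q" for x
      by (simp add: cr_def algebra_simps)
    have qUV: "\<bar>cr q (u i)\<bar> = \<bar>t\<bar>" "\<bar>cr q (u j)\<bar> = \<bar>t + M * s\<bar>" "cr q (u k) = 0"
    proof -
      show "\<bar>cr q (u i)\<bar> = \<bar>t\<bar>" using stk(2) cr_commute[of q U] by (simp add: U_def)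
      have "cr q V = - of_int (t + M * s)" using stk crV[of q] M cr_commute[of q V] by simp
      then have "\<bar>cr q V\<bar> = \<bar>of_int (t + M * s)\<bar>" by (simp only: abs_minus_cancel)
      then show "\<bar>cr q (u j)\<bar> = \<bar>t + M * s\<bar>" using w(1) by (simp add: Vj abs_mult)
    qed (simp add: q_def)
    have "M = 1 \<or> (M = 2 \<and> \<bar>s\<bar> = 1) \<or> (M = 3 \<and> \<bar>s\<bar> = 1)"
    proof (cases "M \<ge> 2")
      case True
      then have "real_of_int (\<bar>s\<bar> * M) < 4" using small[OF _ k(1-3)] M stk(1) by (simp add: q_def)
      then have "\<bar>s\<bar> * M < 4" by linarith
      moreover have "M \<le> \<bar>s\<bar> * M" using sk(1) True by simp
      ultimately have "M = 2 \<or> M = 3" using True by linarith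
      then show ?thesis using \<open>\<bar>s\<bar> * M < 4\<close> sk(1) by auto
    qed (use M1 in auto)
    then consider (1) "M = 1" | (2) "M = 2" "\<bar>s\<bar> = 1" | (3) "M = 3" "\<bar>s\<bar> = 1" by blast
    then show False
    proof cases
      case 1
      \<comment> \<open>All determinants are at most 1. The width across \<open>q\<close> is so far
        2, hence there is a fourth generator; its determinant with \<open>q\<close> comes out as 0
        or 2 in absolute value, both impossible.\<close>
      have s2: "\<bar>t\<bar> = 1" "s = - 2 * t" using sk[unfolded 1] by arith+
      have "\<bar>t + M * s\<bar> = 1" using s2 1 by auto
      then have "(\<Sum>l\<in>{i, j, k}. \<bar>cr q (u l)\<bar>) < 3" using qUV s2(1) k ij(3) by simp
      then obtain l where l: "l \<in> N" "l \<noteq> i" "l \<noteq> j" "l \<noteq> k" "cr q (u l) \<noteq> 0"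
        using other[OF q, of "{i, j, k}"] ij k(1) by auto
      obtain s' t' where l': "cr w (u l) = of_int s'" "cr U (u l) = of_int t'" using ints[OF l(1)] by blast
      have sl: "\<bar>t'\<bar> = 1" "s' = 0 \<or> s' = - 2 * t'" using st[OF l(1-3) l', unfolded 1] by arith+
      define z where "z = t * (s' + 2 * t')"
      have "cr U w * cr q (u l) = of_int z"
        unfolding pl stk l' s2(2) z_def by (simp add: algebra_simps)
      then have "\<bar>cr U w * cr q (u l)\<bar> = of_int \<bar>z\<bar>" by simp
      then have z: "\<bar>cr q (u l)\<bar> = of_int \<bar>z\<bar>" using Uw by (simp add: abs_mult)
      have "\<bar>cr q (u l)\<bar> \<le> 1" using max[OF k(1) l(1)] l(4) M 1 by (simp add: q_def)
      then have "\<bar>z\<bar> \<le> 1" unfolding z by linarith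
      moreover have "z \<noteq> 0" using z l(5) by auto
      moreover have "z = 0 \<or> \<bar>z\<bar> = 2" using sl s2(1) unfolding z_def by (auto simp: abs_mult)
      ultimately show False by linarith
    next
      case 2
      \<comment> \<open>Again \<open>q\<close> sees width 2 only. The fourth generator is transverse
        to \<open>w\<close> by \<open>noL\<close>, so it obeys the same relation between coordinates
        as \<open>q\<close> and is parallel to it.\<close>
      have ts: "t = - s" using sk[unfolded 2(1)] 2(2) by arith
      have "\<bar>t\<bar> = 1" "\<bar>t + M * s\<bar> = 1" using ts 2 by auto
      then have "(\<Sum>l\<in>{i, j, k}. \<bar>cr q (u l)\<bar>) < 3" using qUV k ij(3) by simp
      then obtain l where l: "l \<in> N" "l \<noteq> i" "l \<noteq> j" "l \<noteq> k" "cr q (u l) \<noteq> 0"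
        using other[OF q, of "{i, j, k}"] ij k(1) by auto
      obtain s' t' where l': "cr w (u l) = of_int s'" "cr U (u l) = of_int t'" using ints[OF l(1)] by blast
      have "real_of_int \<bar>s'\<bar> * 2 < 4" using small[OF _ l(1-3)] M 2 l'(1) by simp
      then have "\<bar>s'\<bar> \<le> 1" by linarith
      moreover have "s' \<noteq> 0" using noL[OF _ k l(1-4)] M 2 l'(1) by auto
      ultimately have "t' = - s'" using st[OF l(1-3) l', unfolded 2(1)] by arith
      then have "cr U w * cr q (u l) = 0" unfolding pl stk l' ts by simp
      then show False using l(5) Uw by auto
    next
      case 3
      \<comment> \<open>The bounds leave two positions for \<open>q\<close>; up to sign it is
        \<open>U + w\<close> or \<open>U + 2w\<close>, as \<open>covers4_thin_3\<close>
        requires.\<close>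
      define e where "e = cr w U"
      have e: "e * e = 1" using wU by (auto simp: e_def abs_if split: if_splits)
      define \<sigma> where "\<sigma> = of_int s * e"
      define b where "b = real_of_int (- s * t)"
      have ss: "real_of_int s * real_of_int s = 1" using 3(2) by (auto simp: abs_if split: if_splits)
      have sig: "\<bar>\<sigma>\<bar> = 1" using 3(2) wU by (simp add: \<sigma>_def e_def abs_mult flip: of_int_abs)
      have "\<sigma> *\<^sub>R q = U + b *\<^sub>R w"
      proof -
        have "cr w (e *\<^sub>R U) = 1" using e by (simp add: e_def)
        from cr_expand[OF this, of "\<sigma> *\<^sub>R q"]
        have "\<sigma> *\<^sub>R q = (\<sigma> * (e * cr q U)) *\<^sub>R w + (\<sigma> * of_int s * e) *\<^sub>R U"
          by (simp add: stk(1) mult.assoc)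
        moreover have "\<sigma> * of_int s * e = 1" using ss e unfolding \<sigma>_def by algebra
        moreover have "\<sigma> * (e * cr q U) = b" unfolding \<sigma>_def b_def using stk(2) cr_commute[of q U] e
          by (simp add: mult.assoc)
        ultimately show ?thesis by simp
      qed
      moreover have "b = 1 \<or> b = 2"
      proof -
        have "s = 1 \<or> s = -1" using 3(2) by linarith
        then have "- s * t = 1 \<or> - s * t = 2" using sk 3(1) by auto
        then show ?thesis unfolding b_def by fastforce
      qed
      moreover have "a *\<^sub>R U + c *\<^sub>R V + d *\<^sub>R (\<sigma> *\<^sub>R q) \<in> ?D" if "\<bar>a\<bar> \<le> 1" "\<bar>c\<bar> \<le> 1" "\<bar>d\<bar> \<le> 1" for a c d
        using mem[OF k(1-3) that(1,2), of "d * \<sigma>"] that(3) sig by (simp add: q_def abs_mult)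
      moreover have "V = U + 3 *\<^sub>R w" using V_def M 3(1) by simp
      ultimately show False using covers4_thin_3[OF UI w(2) Uw] no by blast
    qed
  qed
qed

subsection \<open>Planar zonotopes of large area and the theorem\<close>

lemma covers_translate: "covers \<rho> C \<Longrightarrow> covers \<rho> ((+) t ` C)"
  unfolding covers_def
proof
  fix x assume "\<forall>x. \<exists>c\<in>C. x - \<rho> *\<^sub>R c \<in> int_lattice"
  then obtain c where "c \<in> C" "(x - \<rho> *\<^sub>R t) - \<rho> *\<^sub>R c \<in> int_lattice" by blast
  then show "\<exists>c\<in>(+) t ` C. x - \<rho> *\<^sub>R c \<in> int_lattice"
    by (intro bexI[of _ "t + c"]) (auto simp: algebra_simps)
qed

lemma inverse_bounds:
  fixes c :: real
  assumes "0 < a" "a \<le> c" shows "1 / c \<le> 1 / a"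
  using assms by (simp add: divide_simps)

text \<open>The width \<open>l\<close> across the Minkowski direction is an integer. For \<open>l = 3\<close> the chord comes from
  \<open>area \<le> 3 * chord\<close>, for \<open>l \<ge> 4\<close> from Minkowski's theorem; the numerical cases balance this against the
  chord length \<open>s\<close> available in the third dimension.\<close>

lemma covers_large_area:
  fixes u :: "'i \<Rightarrow> real^2"
  assumes fin: "finite I" and int: "\<And>i. i \<in> I \<Longrightarrow> u i \<in> int_lattice"
    and width: "\<And>x. x \<in> int_lattice \<Longrightarrow> x \<noteq> 0 \<Longrightarrow> (\<Sum>i\<in>I. \<bar>cr x (u i)\<bar>) \<ge> 3"
    and A: "A = measure lebesgue (zon I u)" "A \<ge> 19"
  obtains \<rho> s where "\<rho> > 0" "s > 0" "covers \<rho> (zon I u)" "s * A < 196 \<or> s = 29 / 5" "\<rho> + 1 / s < 3 / 5"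
proof -
  note result = that
  \<comment> \<open>Minkowski needs the square of \<open>C\<close> strictly below \<open>A\<close>;
    the factor loses so little that the square still exceeds 998/1000 times \<open>A\<close>, as
    used below.\<close>
  define C where "C = (999/1000) * sqrt A"
  have C0: "C > 0" using A(2) by (simp add: C_def)
  have CC: "C\<^sup>2 = (999/1000)\<^sup>2 * A"
    using A(2) power_mult_distrib[of "999/1000" "sqrt A" 2] by (simp only: C_def real_sqrt_pow2)
  then have "C\<^sup>2 < A" using A(2) by (simp add: power2_eq_square)
  then have "C ^ CARD(2) < measure lebesgue (zon I u)" using A(1) by simp
  then obtain z x0 where z: "z \<in> int_lattice" "z \<noteq> 0" and x0: "x0 \<in> zon I u" "x0 + C *\<^sub>R z \<in> zon I u"
    using minkowski_chord[OF compact_zon[OF fin] C0, of u] by auto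
  obtain g p r where g: "g \<ge> 1" "z = g *\<^sub>R p" and p: "p \<in> int_lattice" "r \<in> int_lattice" "cr p r = 1"
    using primitive_2[OF z] by metis
  have "x0 + (C * g) *\<^sub>R p \<in> zon I u" using x0(2) g(2) by simp
  then have x0': "x0 + C *\<^sub>R p \<in> zon I u"
    using C0 g(1) by (rule_tac chord_shorten[OF convex_zon x0(1), of "C * g"]) auto
  define l where "l = (\<Sum>i\<in>I. \<bar>cr p (u i)\<bar>)"
  have "p \<noteq> 0" using p(3) by auto
  then have l3: "l \<ge> 3" using width[OF p(1)] by (simp add: l_def)
  have "l \<in> \<int>" unfolding l_def using int p(1) by (intro Ints_sum Ints_abs cr_Ints)
  then have "l = 3 \<or> l \<ge> 4" using l3 by (auto elim!: Ints_cases)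
  then show ?thesis
  proof
    assume l: "l = 3"
    \<comment> \<open>A chord from Fubini across the same direction \<open>p\<close>, better than
      Minkowski's because the width is only 3.\<close>
    have cov: "covers (1 / 3 + 1 / c) (zon I u)" if c: "c > 0" "3 * c < A" for c
    proof -
      have "c * measure lebesgue (proj1 p ` zon I u) \<le> c * l"
        using measure_proj1_zon[OF fin, of p u] c(1) by (intro mult_left_mono) (auto simp: l_def)
      also have "\<dots> < measure lebesgue (zon I u)" using c l A(1) by (simp add: mult.commute)
      finally obtain x where "x \<in> zon I u" "x + c *\<^sub>R p \<in> zon I u"
        using chord_2[OF p(3) compact_zon[OF fin] convex_zon c(1)] by blast
      then show ?thesis using covers_chord_2[OF fin l_def _ p _ _ c(1)] l by simp
    qed
    have res: thesis if "c > 0" "3 * c < A" "s > 0" "s * A < 196 \<or> s = 29/5" "1/3 + 1/c + 1/s < 3/5" for c s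
    proof (rule result[of "1/3 + 1/c" s])
      show "0 < 1/3 + 1/c" using that(1) by (simp add: add_pos_pos)
    qed (use that cov in auto)
    \<comment> \<open>On each interval \<open>c\<close> is just below a third of the lower end.
      Until the last one, \<open>s\<close> is just below 196 divided by the upper end; then 29/5
      takes over.\<close>
    consider "A < 20" | "20 \<le> A" "A < 22" | "22 \<le> A" "A < 25" | "25 \<le> A" "A < 28" | "28 \<le> A" "A < 31"
      | "31 \<le> A" "A < 33" | "33 \<le> A" by linarith
    then show thesis
    proof cases
      case 1 then show ?thesis using A(2) by (intro res[of "633/100" "979/100"]) auto
    next
      case 2 then show ?thesis by (intro res[of "666/100" "89/10"]) auto
    next
      case 3 then show ?thesis by (intro res[of "733/100" "783/100"]) auto
    next
      case 4 then show ?thesis by (intro res[of "833/100" "699/100"]) auto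
    next
      case 5 then show ?thesis by (intro res[of "933/100" "632/100"]) auto
    next
      case 6 then show ?thesis by (intro res[of "1033/100" "593/100"]) auto
    next
      case 7 then show ?thesis by (intro res[of "109/10" "29/5"]) auto
    qed
  next
    assume l: "l \<ge> 4"
    have "1 / l \<le> 1 / 4" using l by (intro inverse_bounds) auto
    have cov: "covers (1 / l + 1 / C) (zon I u)"
      using covers_chord_2[OF fin l_def _ p x0(1) x0' C0] l by simp
    have res: thesis if c: "c > 0" "c * c \<le> (998/1000) * A" "s > 0" "s * A < 196 \<or> s = 29/5" "1/4 + 1/c + 1/s < 3/5" for c s
    proof -
      have "(998/1000) * A \<le> (999/1000)\<^sup>2 * A" using A(2) by (simp add: power2_eq_square)
      then have "c\<^sup>2 \<le> C\<^sup>2" using c(2) unfolding CC by (simp add: power2_eq_square)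
      then have "c \<le> C" using C0 by (simp add: power2_le_iff_abs_le)
      then have "1 / C \<le> 1 / c" using c(1) by (intro inverse_bounds)
      then have "1 / l + 1 / C + 1 / s < 3/5" using \<open>1 / l \<le> 1 / 4\<close> c(5) by linarith
      moreover have "0 < 1 / l + 1 / C" using C0 l by (simp add: add_pos_pos)
      ultimately show thesis using c(3,4) cov by (intro result[of "1/l + 1/C" s])
    qed
    \<comment> \<open>The same scheme, with \<open>c\<close> just below the square root of 998/1000
      times the lower end.\<close>
    consider "A < 23" | "23 \<le> A" "A < 27" | "27 \<le> A" "A < 30" | "30 \<le> A" "A < 32" | "32 \<le> A" by linarith
    then show thesis
    proof cases
      case 1 then show ?thesis using A(2) by (intro res[of "435/100" "85/10"]) auto
    next
      case 2 then show ?thesis by (intro res[of "479/100" "725/100"]) auto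
    next
      case 3 then show ?thesis by (intro res[of "519/100" "653/100"]) auto
    next
      case 4 then show ?thesis by (intro res[of "547/100" "612/100"]) auto
    next
      case 5 then show ?thesis by (intro res[of "565/100" "29/5"]) auto
    qed
  qed
qed

section \<open>Recognising the exceptional parallelepiped and its projection\<close>

lemma mem_segment_sum_3:
  "x \<in> closed_segment 0 a + closed_segment 0 b + closed_segment 0 c \<longleftrightarrow>
    (\<exists>r s t. 0 \<le> r \<and> r \<le> 1 \<and> 0 \<le> s \<and> s \<le> 1 \<and> 0 \<le> t \<and> t \<le> 1 \<and> x = r *\<^sub>R a + s *\<^sub>R b + t *\<^sub>R c)"
  (is "_ \<longleftrightarrow> ?R")
proof
  assume "x \<in> closed_segment 0 a + closed_segment 0 b + closed_segment 0 c"
  then show ?R by (fastforce elim!: set_plus_elim simp: in_segment)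
next
  assume ?R
  then obtain r s t where "0 \<le> r" "r \<le> 1" "0 \<le> s" "s \<le> 1" "0 \<le> t" "t \<le> 1" "x = r *\<^sub>R a + s *\<^sub>R b + t *\<^sub>R c" by blast
  then show "x \<in> closed_segment 0 a + closed_segment 0 b + closed_segment 0 c"
    by (auto intro!: set_plus_intro simp: in_segment)
qed

text \<open>The generators along \<open>z\<close> merge into one segment, of positive length because
  the dimension is three. It is independent of the other two edges since \<open>\<pi>\<close> kills
  it while their images are independent.\<close>

lemma parallelepiped_zon:
  fixes u :: "'i \<Rightarrow> real^3" and \<pi> :: "real^3 \<Rightarrow> real^2"
  assumes fin: "finite I" and ij: "i \<in> I" "j \<in> I" "i \<noteq> j"
    and lin: "linear \<pi>" and z: "\<pi> z = 0" "z \<noteq> 0"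
    and others: "\<And>k. k \<in> I \<Longrightarrow> k \<noteq> i \<Longrightarrow> k \<noteq> j \<Longrightarrow> \<exists>s. u k = s *\<^sub>R z"
    and indep: "cr (\<pi> (u i)) (\<pi> (u j)) \<noteq> 0"
    and dim: "aff_dim ((+) t ` zon I u) = 3"
  shows "parallelepiped ((+) t ` zon I u)"
proof -
  define K where "K = I - {i, j}"
  have K: "finite K" using fin by (simp add: K_def)
  have "\<forall>k\<in>K. \<exists>s. u k = s *\<^sub>R z" using others by (auto simp: K_def)
  then obtain \<kappa> where \<kappa>: "\<And>k. k \<in> K \<Longrightarrow> u k = \<kappa> k *\<^sub>R z" by metis
  define L where "L = (\<Sum>k\<in>K. \<bar>\<kappa> k\<bar>)"
  define m where "m = (\<Sum>k\<in>K. min 0 (\<kappa> k))"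
  have split: "(\<Sum>k\<in>I. s k *\<^sub>R u k) = s i *\<^sub>R u i + s j *\<^sub>R u j + (\<Sum>k\<in>K. s k * \<kappa> k) *\<^sub>R z" for s
  proof -
    have I: "insert i (insert j K) = I" using ij by (auto simp: K_def)
    have "i \<notin> insert j K" "j \<notin> K" using ij(3) by (auto simp: K_def)
    then have "(\<Sum>k\<in>insert i (insert j K). s k *\<^sub>R u k) = s i *\<^sub>R u i + (s j *\<^sub>R u j + (\<Sum>k\<in>K. s k *\<^sub>R u k))"
      using K by simp
    then have "(\<Sum>k\<in>I. s k *\<^sub>R u k) = s i *\<^sub>R u i + (s j *\<^sub>R u j + (\<Sum>k\<in>K. s k *\<^sub>R u k))"
      unfolding I .
    also have "(\<Sum>k\<in>K. s k *\<^sub>R u k) = (\<Sum>k\<in>K. (s k * \<kappa> k) *\<^sub>R z)"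
      using \<kappa> by (intro sum.cong) auto
    finally show ?thesis by (simp add: scaleR_sum_left add.assoc)
  qed
  have L: "L > 0"
  proof (rule ccontr)
    assume "\<not> L > 0"
    moreover have "L \<ge> 0" by (simp add: L_def sum_nonneg)
    ultimately have "L = 0" by simp
    then have k0: "\<kappa> k = 0" if "k \<in> K" for k using that K by (simp add: L_def sum_nonneg_eq_0_iff)
    have "a *\<^sub>R u i + b *\<^sub>R u j \<in> span {u i, u j}" for a b
      by (intro span_add span_scale) (auto intro: span_base)
    then have "zon I u \<subseteq> span {u i, u j}"
      unfolding zon_def using k0 by (auto simp: split)
    then have "aff_dim (zon I u) \<le> aff_dim (span {u i, u j})" by (rule aff_dim_subset)
    also have "\<dots> = int (dim (span {u i, u j}))" by (simp add: aff_dim_subspace)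
    also have "\<dots> = int (dim {u i, u j})" by simp
    also have "\<dots> \<le> int (card {u i, u j})" using dim_le_card'[of "{u i, u j}"] by simp
    also have "\<dots> \<le> 2" by (simp add: card_insert_if)
    finally show False using dim by (simp add: aff_dim_translation_eq)
  qed
  have mem: "x \<in> zon I u \<longleftrightarrow> (\<exists>a b c. 0 \<le> a \<and> a \<le> 1 \<and> 0 \<le> b \<and> b \<le> 1 \<and> 0 \<le> c \<and> c \<le> 1
      \<and> x = m *\<^sub>R z + (a *\<^sub>R u i + b *\<^sub>R u j + c *\<^sub>R (L *\<^sub>R z)))" (is "_ \<longleftrightarrow> ?R") for x
  proof
    assume "x \<in> zon I u"
    then obtain s where s: "x = (\<Sum>k\<in>I. s k *\<^sub>R u k)" "\<forall>k\<in>I. 0 \<le> s k \<and> s k \<le> 1" by (auto simp: zon_def)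
    define d where "d = (\<Sum>k\<in>K. s k * \<kappa> k)"
    have sK: "0 \<le> s k" "s k \<le> 1" if "k \<in> K" for k using s(2) that by (auto simp: K_def)
    have bnd: "min 0 (\<kappa> k) \<le> s k * \<kappa> k \<and> s k * \<kappa> k \<le> min 0 (\<kappa> k) + \<bar>\<kappa> k\<bar>" if "k \<in> K" for k
      using sK[OF that] mult_left_le_one_le[of "\<kappa> k" "s k"] mult_left_le_one_le[of "- \<kappa> k" "s k"]
        mult_nonneg_nonpos[of "s k" "\<kappa> k"] mult_nonneg_nonneg[of "s k" "\<kappa> k"]
      by (cases "\<kappa> k \<ge> 0") auto
    have "m \<le> d" unfolding m_def d_def using bnd by (intro sum_mono) auto
    moreover have "d \<le> m + L" unfolding m_def d_def L_def sum.distrib[symmetric] using bnd by (intro sum_mono) auto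
    ultimately have "0 \<le> (d - m) / L" "(d - m) / L \<le> 1" using L by auto
    moreover have "x = m *\<^sub>R z + (s i *\<^sub>R u i + s j *\<^sub>R u j + ((d - m) / L) *\<^sub>R (L *\<^sub>R z))"
      using L unfolding s(1) split d_def[symmetric] by (simp add: scaleR_diff_left)
    ultimately show ?R using s(2) ij by blast
  next
    assume ?R
    then obtain a b c where abc: "0 \<le> a" "a \<le> 1" "0 \<le> b" "b \<le> 1" "0 \<le> c" "c \<le> 1"
      and x: "x = m *\<^sub>R z + (a *\<^sub>R u i + b *\<^sub>R u j + c *\<^sub>R (L *\<^sub>R z))" by blast
    \<comment> \<open>Generators pointing against \<open>z\<close> get the complementary
      coefficient, so that all move together from the lower end \<open>m\<close> of the merged
      segment.\<close>
    define s where "s k = (if k = i then a else if k = j then b else if \<kappa> k \<ge> 0 then c else 1 - c)" for k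
    have "(\<Sum>k\<in>K. s k * \<kappa> k) = (\<Sum>k\<in>K. min 0 (\<kappa> k) + c * \<bar>\<kappa> k\<bar>)"
      by (intro sum.cong) (auto simp: s_def K_def algebra_simps)
    also have "\<dots> = m + c * L" by (simp add: sum.distrib m_def L_def sum_distrib_left)
    finally have "x = (\<Sum>k\<in>I. s k *\<^sub>R u k)" unfolding split x using ij(3) by (simp add: s_def algebra_simps)
    then show "x \<in> zon I u" unfolding zon_def using abc by (intro CollectI exI[of _ s]) (auto simp: s_def)
  qed
  define w where "w = L *\<^sub>R z"
  have w: "w \<noteq> 0" "\<pi> w = 0" using L z lin by (auto simp: w_def linear_scale)
  define g :: "3 \<Rightarrow> real^3" where "g k = (if k = 1 then u i else if k = 2 then u j else w)" for k
  have nz: "\<pi> (u i) \<noteq> 0" "\<pi> (u j) \<noteq> 0" using indep by auto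
  have diff: "u i \<noteq> u j" "u i \<noteq> w" "u j \<noteq> w" using indep nz w by auto
  have gs: "g 1 = u i" "g 2 = u j" "g 3 = w" by (simp_all add: g_def)
  have "inj g" unfolding inj_def forall_3 using diff gs by auto
  moreover have "independent (range g)"
  proof -
    have "range g = {u i, u j, w}" by (auto simp: UNIV_3 gs)
    moreover have "independent {w}" using w(1) by simp
    moreover have "u j \<notin> span {w}"
      using nz w(2) lin by (auto simp: span_singleton linear_scale)
    moreover have "u i \<notin> span {u j, w}"
    proof
      assume "u i \<in> span {u j, w}"
      then obtain a b where "u i - a *\<^sub>R u j = b *\<^sub>R w" by (auto simp: span_breakdown_eq span_singleton)
      then have "\<pi> (u i - a *\<^sub>R u j) = 0" using w(2) lin by (simp add: linear_scale)
      then have "\<pi> (u i) = a *\<^sub>R \<pi> (u j)" using lin by (simp add: linear_diff linear_scale)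
      then show False using indep by simp
    qed
    ultimately show ?thesis using diff by (simp add: independent_insert)
  qed
  moreover have "(+) t ` zon I u = (+) (t + m *\<^sub>R z) ` (\<Sum>k\<in>UNIV. closed_segment 0 (g k))"
  proof -
    have "(\<Sum>k\<in>UNIV. closed_segment 0 (g k)) = closed_segment 0 (u i) + closed_segment 0 (u j) + closed_segment 0 w"
      by (simp add: sum_3 gs)
    moreover have "zon I u = (+) (m *\<^sub>R z) ` (closed_segment 0 (u i) + closed_segment 0 (u j) + closed_segment 0 w)"
      unfolding set_eq_iff mem image_iff Bex_def mem_segment_sum_3 w_def by blast
    ultimately show ?thesis by (simp add: image_image add.assoc)
  qed
  ultimately show ?thesis unfolding parallelepiped_def by blast
qed

text \<open>The matrix with columns \<open>e\<close> and \<open>r\<close> sends the edges (1,0) and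
  (2,5) to \<open>e\<close> and \<open>u j\<close>.\<close>

lemma unimodular_P_2_5_zon:
  fixes u :: "'i \<Rightarrow> real^2"
  assumes fin: "finite I" and ij: "i \<in> I" "j \<in> I" "i \<noteq> j"
    and others: "\<And>k. k \<in> I \<Longrightarrow> k \<noteq> i \<Longrightarrow> k \<noteq> j \<Longrightarrow> u k = 0"
    and e: "e \<in> int_lattice" "r \<in> int_lattice" "\<bar>cr e r\<bar> = 1" "u i = e \<or> u i = - e" "u j = 2 *\<^sub>R e + 5 *\<^sub>R r"
    and t: "t \<in> int_lattice"
  shows "unimodularly_equivalent ((+) t ` zon I u) P_2_5"
proof -
  have zon: "zon I u = {a *\<^sub>R u i + b *\<^sub>R u j | a b. 0 \<le> a \<and> a \<le> 1 \<and> 0 \<le> b \<and> b \<le> 1}" (is "_ = ?R")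
  proof -
    have split: "(\<Sum>k\<in>I. s k *\<^sub>R u k) = s i *\<^sub>R u i + s j *\<^sub>R u j" for s
    proof -
      have "(\<Sum>k\<in>I. s k *\<^sub>R u k) = (\<Sum>k\<in>{i, j}. s k *\<^sub>R u k)"
        using ij others by (intro sum.mono_neutral_right fin) auto
      then show ?thesis using ij(3) by simp
    qed
    show ?thesis
    proof (intro equalityI subsetI)
      fix x assume "x \<in> zon I u" then show "x \<in> ?R" using ij by (auto simp: zon_def split)
    next
      fix x assume "x \<in> ?R"
      then obtain a b where "x = a *\<^sub>R u i + b *\<^sub>R u j" "0 \<le> a" "a \<le> 1" "0 \<le> b" "b \<le> 1" by blast
      then show "x \<in> zon I u" unfolding zon_def using ij(3)
        by (intro CollectI exI[of _ "\<lambda>k. if k = i then a else if k = j then b else 0"]) (auto simp: split)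
    qed
  qed
  have P: "P_2_5 = {vector [a + 2 * b, 5 * b] | a b. 0 \<le> a \<and> a \<le> 1 \<and> 0 \<le> b \<and> b \<le> (1::real)}"
    (is "_ = ?V")
  proof (intro equalityI subsetI)
    fix x assume "x \<in> P_2_5"
    then obtain a b where "0 \<le> a" "a \<le> 1" "0 \<le> b" "b \<le> 1" "x = a *\<^sub>R vector [1, 0] + b *\<^sub>R vector [2, 5]"
      unfolding P_2_5_def by (auto elim!: set_plus_elim simp: in_segment)
    then show "x \<in> ?V" by (auto simp: vec_eq_iff forall_2 intro!: exI[of _ a] exI[of _ b])
  next
    fix x assume "x \<in> ?V"
    then obtain a b where ab: "0 \<le> a" "a \<le> 1" "0 \<le> b" "b \<le> 1" "x = vector [a + 2 * b, 5 * b]" by blast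
    then have "x = a *\<^sub>R vector [1, 0] + b *\<^sub>R vector [2, 5]" by (simp add: vec_eq_iff forall_2)
    moreover have "a *\<^sub>R vector [1, 0] \<in> closed_segment 0 (vector [1, 0] :: real^2)"
      "b *\<^sub>R vector [2, 5] \<in> closed_segment 0 (vector [2, 5] :: real^2)"
      using ab by (auto simp: in_segment)
    ultimately show "x \<in> P_2_5" unfolding P_2_5_def by (simp add: set_plus_intro)
  qed
  define U :: "real^2^2" where "U = vector [vector [e $ 1, r $ 1], vector [e $ 2, r $ 2]]"
  have U: "U *v vector [a + 2 * b, 5 * b] = a *\<^sub>R e + b *\<^sub>R u j" for a b
    by (simp add: U_def e(5) vec_eq_iff forall_2 matrix_vector_mult_def sum_2 algebra_simps)
  have det: "\<bar>det U\<bar> = 1" using e(3) by (simp add: det_2 U_def cr_def mult.commute)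
  have int: "U $ k $ l \<in> \<int>" for k l
  proof -
    have "\<forall>k l. U $ k $ l \<in> \<int>" using e(1,2) by (auto simp: U_def forall_2 int_lattice_def)
    then show ?thesis by blast
  qed
  have UP: "(\<lambda>x. U *v x) ` P_2_5 = {a *\<^sub>R e + b *\<^sub>R u j | a b. 0 \<le> a \<and> a \<le> 1 \<and> 0 \<le> b \<and> b \<le> 1}"
    unfolding P by (force simp: image_iff U)
  \<comment> \<open>A reversed first edge only translates the parallelogram by
    \<open>- e\<close>.\<close>
  obtain t' where t': "t' \<in> int_lattice" "zon I u = (+) t' ` ((\<lambda>x. U *v x) ` P_2_5)"
  proof (cases "u i = e")
    case True
    have "(+) 0 ` X = X" for X :: "(real^2) set" by auto
    then show ?thesis using that[of 0] zon UP True by (simp add: int_lattice_zero)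
  next
    case False
    then have ui: "u i = - e" using e(4) by blast
    have "zon I u = (+) (- e) ` {a *\<^sub>R e + b *\<^sub>R u j | a b. 0 \<le> a \<and> a \<le> 1 \<and> 0 \<le> b \<and> b \<le> 1}" (is "_ = _ ` ?S")
      unfolding zon ui
    proof (intro equalityI subsetI)
      fix x assume "x \<in> {a *\<^sub>R - e + b *\<^sub>R u j | a b. 0 \<le> a \<and> a \<le> 1 \<and> 0 \<le> b \<and> b \<le> 1}"
      then obtain a b where "x = a *\<^sub>R - e + b *\<^sub>R u j" "0 \<le> a" "a \<le> 1" "0 \<le> b" "b \<le> 1" by blast
      then have "x = - e + ((1 - a) *\<^sub>R e + b *\<^sub>R u j)" "0 \<le> 1 - a" "1 - a \<le> 1" "0 \<le> b" "b \<le> 1"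
        by (simp_all add: algebra_simps)
      moreover from this have "(1 - a) *\<^sub>R e + b *\<^sub>R u j \<in> ?S" by blast
      ultimately show "x \<in> (+) (- e) ` ?S" by blast
    next
      fix x assume "x \<in> (+) (- e) ` ?S"
      then obtain a b where "x = - e + (a *\<^sub>R e + b *\<^sub>R u j)" "0 \<le> a" "a \<le> 1" "0 \<le> b" "b \<le> 1" by blast
      then have "x = (1 - a) *\<^sub>R - e + b *\<^sub>R u j" "0 \<le> 1 - a" "1 - a \<le> 1" "0 \<le> b" "b \<le> 1"
        by (simp_all add: algebra_simps)
      then show "x \<in> {a *\<^sub>R - e + b *\<^sub>R u j | a b. 0 \<le> a \<and> a \<le> 1 \<and> 0 \<le> b \<and> b \<le> 1}" by blast
    qed
    then show ?thesis using that[of "- e"] e(1) UP by (simp add: int_lattice_minus)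
  qed
  have "(+) t ` zon I u = (\<lambda>x. U *v x + (t + t')) ` P_2_5"
    unfolding t'(2) image_image by (simp add: algebra_simps)
  then show ?thesis unfolding unimodularly_equivalent_def
    using int det t t'(1) by (intro exI[of _ U] bexI[of _ "t + t'"]) (auto intro: int_lattice_add)
qed

section \<open>From the planar bounds to dimension three\<close>

theorem theorem5:
  fixes Z :: "(real ^ 3) set"
  assumes "lattice_3_zonotope Z"
    and "lattice_width Z \<ge> 3"
    and "measure lebesgue Z \<ge> 196"
  shows "covering_radius Z < 3 / 5 \<or> (parallelepiped Z \<and> projects_onto Z P_2_5)"
proof -
  obtain n u t where aff: "aff_dim Z = 3" and t: "t \<in> int_lattice" and ui: "\<forall>i<n. u i \<in> int_lattice"
    and "Z = (+) t ` zonotope n u"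
    using assms(1) unfolding lattice_3_zonotope_def by blast
  define I where "I = {..<n}"
  have Z: "Z = (+) t ` zon I u" using \<open>Z = _\<close> by (simp add: zonotope_eq_zon I_def)
  have fin: "finite I" by (simp add: I_def)
  have int: "u i \<in> int_lattice" if "i \<in> I" for i using that ui by (simp add: I_def)
  have width3: "(\<Sum>i\<in>I. \<bar>y \<bullet> u i\<bar>) \<ge> 3" if "y \<in> int_lattice" "y \<noteq> 0" for y
    using lattice_width_zon_le[OF fin that, of t u] assms(2) unfolding Z by linarith
  have cZ: "compact Z" unfolding Z using compact_translation[OF compact_zon[OF fin]] by (simp add: image_def)
  have vZ: "convex Z" unfolding Z by (intro convex_translation convex_zon)
  have "(29/5) ^ CARD(3) < measure lebesgue Z" using assms(3) by (simp add: power3_eq_cube)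
  then obtain z x where z: "z \<in> int_lattice" "z \<noteq> 0" and x: "x \<in> Z" "x + (29/5) *\<^sub>R z \<in> Z"
    using minkowski_chord[OF cZ, of "29/5"] by auto
  show ?thesis
  proof (rule primitive_projection_3[OF z])
    fix g z0 and \<pi> :: "real^3 \<Rightarrow> real^2"
    assume g: "g \<ge> 1" "z = g *\<^sub>R z0" and z0: "z0 \<in> int_lattice" "z0 \<noteq> 0"
      and lin: "linear \<pi>" and piz: "\<pi> z0 = 0" and ker: "\<And>x. \<pi> x = 0 \<Longrightarrow> \<exists>s. x = s *\<^sub>R z0"
      and surj: "\<pi> ` int_lattice = int_lattice"
      and dual: "\<And>y. y \<in> int_lattice - {0} \<Longrightarrow> \<exists>y'\<in>int_lattice - {0}. \<forall>x. y \<bullet> \<pi> x = y' \<bullet> x"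
      and chord: "\<And>C s. compact C \<Longrightarrow> convex C \<Longrightarrow> s > 0 \<Longrightarrow> s * measure lebesgue (\<pi> ` C) < measure lebesgue C
        \<Longrightarrow> \<exists>x. x \<in> C \<and> x + s *\<^sub>R z0 \<in> C"
    define v where "v = \<pi> \<circ> u"
    define W where "W = zon I v"
    have vI: "v i \<in> int_lattice" if "i \<in> I" for i using int[OF that] surj by (auto simp: v_def)
    have piZ: "\<pi> ` Z = (+) (\<pi> t) ` W"
      unfolding Z W_def v_def by (simp add: translate_linear_image[OF lin] linear_image_zon[OF lin])
    \<comment> \<open>A quarter turn writes \<open>cr y\<close> as an inner product, which
      \<open>dual\<close> pulls back to an integer functional on the space of
      \<open>Z\<close>.\<close>
    have width2: "(\<Sum>i\<in>I. \<bar>cr y (v i)\<bar>) \<ge> 3" if y: "y \<in> int_lattice" "y \<noteq> 0" for y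
    proof -
      let ?y = "vector [- y $ 2, y $ 1] :: real^2"
      have "?y \<in> int_lattice - {0}" using y by (auto simp: int_lattice_def forall_2 vec_eq_iff)
      then obtain y' where y': "y' \<in> int_lattice - {0}" "\<And>x. ?y \<bullet> \<pi> x = y' \<bullet> x" using dual by blast
      have "cr y (v i) = y' \<bullet> u i" for i
        using y'(2)[of "u i"] by (simp add: v_def cr_def inner_vec_def sum_2)
      then show ?thesis using width3[of y'] y'(1) by simp
    qed
    define A where "A = measure lebesgue W"
    have A: "measure lebesgue (\<pi> ` Z) = A" by (simp only: piZ measure_translation A_def)
    \<comment> \<open>Either alternative for \<open>s\<close> supplies a chord along
      \<open>z0\<close>: the first by Fubini over the projection, the second by Minkowski's chord
      along the multiple \<open>z\<close> of \<open>z0\<close>.\<close>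
    have fin_cov: "covering_radius Z < 3/5"
      if \<rho>: "\<rho> > 0" "s > 0" "covers \<rho> W" "s * A < 196 \<or> s = 29 / 5" "\<rho> + 1 / s < 3 / 5" for \<rho> s
    proof -
      have "\<exists>x. x \<in> Z \<and> x + s *\<^sub>R z0 \<in> Z"
        using \<rho>(4)
      proof
        assume "s * A < 196"
        then show ?thesis using assms(3) \<rho>(2) by (intro chord cZ vZ) (auto simp: A)
      next
        assume s: "s = 29 / 5"
        have "x + (29/5 * g) *\<^sub>R z0 \<in> Z" using x(2) g(2) by simp
        then have "x + s *\<^sub>R z0 \<in> Z"
          using g(1) s by (rule_tac chord_shorten[OF vZ x(1), of "29/5 * g"]) auto
        then show ?thesis using x(1) by blast
      qed
      then obtain x' where x': "x' \<in> Z" "x' + s *\<^sub>R z0 \<in> Z" by blast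
      have "covers \<rho> (\<pi> ` Z)" unfolding piZ using \<rho>(3) by (rule covers_translate)
      moreover have "\<exists>k\<in>int_lattice. \<pi> k = l" if "l \<in> int_lattice" for l using that surj by (metis imageE)
      ultimately have "covers (\<rho> + 1 / s) Z"
        using covers_fibre[OF lin vZ z0(1) ker _ _ \<rho>(1) x' \<rho>(2)] by blast
      then show ?thesis using \<rho> by (intro covering_radius_less[of "\<rho> + 1 / s"]) (auto simp: add_pos_pos)
    qed
    show ?thesis
    proof (cases "A \<ge> 19")
      case True
      obtain \<rho> s where "\<rho> > 0" "s > 0" "covers \<rho> W" "s * A < 196 \<or> s = 29 / 5" "\<rho> + 1 / s < 3 / 5"
        using covers_large_area[OF fin vI width2 A_def[unfolded W_def] True] unfolding W_def by metis
      then show ?thesis using fin_cov by blast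
    next
      case small: False
      show ?thesis
      proof (cases "covers4 (bzon I v)")
        case True
        then have "covers (1/2) W" unfolding W_def by (rule covers_half_zon)
        \<comment> \<open>Here 19 times 103/10 is 195.7, below 196, while 10/103 is less than
          1/10.\<close>
        then have "covering_radius Z < 3/5" using small by (intro fin_cov[of "1/2" "103/10"]) auto
        then show ?thesis by blast
      next
        case False
        show ?thesis
        proof (rule covers_half_or_P_2_5[OF fin vI width2 False])
          fix i j e r
          assume ij: "i \<in> I" "j \<in> I" "i \<noteq> j"
            and others: "\<And>k. k \<in> I \<Longrightarrow> k \<noteq> i \<Longrightarrow> k \<noteq> j \<Longrightarrow> v k = 0"
            and e: "e \<in> int_lattice" "r \<in> int_lattice" "\<bar>cr e r\<bar> = 1" "v i = e \<or> v i = - e" "v j = 2 *\<^sub>R e + 5 *\<^sub>R r"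
          have "\<pi> t \<in> int_lattice" using t surj by blast
          then have "unimodularly_equivalent (\<pi> ` Z) P_2_5"
            unfolding piZ W_def using unimodular_P_2_5_zon[OF fin ij others e] by blast
          then have "projects_onto Z P_2_5" unfolding projects_onto_def using lin surj by blast
          moreover have "parallelepiped Z"
            unfolding Z
          proof (rule parallelepiped_zon[OF fin ij lin _ z0(2)])
            show "\<pi> z0 = 0" by (rule piz)
            show "\<exists>s. u k = s *\<^sub>R z0" if "k \<in> I" "k \<noteq> i" "k \<noteq> j" for k
              using ker[of "u k"] others[OF that] by (simp add: v_def)
            have "cr (v i) (v j) \<noteq> 0" using e(3-5) by auto
            then show "cr (\<pi> (u i)) (\<pi> (u j)) \<noteq> 0" by (simp add: v_def)
            show "aff_dim ((+) t ` zon I u) = 3" using aff Z by simp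
          qed
          ultimately show ?thesis by blast
        qed
      qed
    qed
  qed
qed

end
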